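(* Let $G$ be a connected graph with $\lambda\neq 0$ as an eigenvalue. Then $$m_\lambda(G)\le \beta'(G)+c(G),$$ and equality holds if and only if $G\cong C_3(a,a,a)$ $(a\ge 0)$, or $G\cong C_5$, or $G$ is a tree with diameter $1$, $2$ or $3$.
   Context: All graphs are simple and undirected. The eigenvalues of a graph $G$ are the eigenvalues of its adjacency matrix $A(G)$, and $m_\lambda(G)$ denotes the multiplicity of $\lambda$ as an eigenvalue of $A(G)$. The cyclomatic number is $c(G)=|E(G)|-|V(G)|+\omega(G)$, where $\omega(G)$ is the number of connected components of $G$. A matching is a set of pairwise non-adjacent edges (no two share a vertex); a matching $M$ of $G$ is induced if no edge of $G$ connects endpoints of two distinct edges of $M$. The induced matching number $\beta'(G)$ is the number of edges in a maximum induced matching of $G$. $C_n$ is the cycle on $n$ vertices. $C_3(a,a,a)$ is the graph obtained from $C_3$ by attaching $a$ pendant vertices to each of its three vertices (so $C_3(0,0,0)=C_3$).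
   Formalization: For a fixed λ the "if" part fails (C_5, λ=2: multiplicity 1 < 2), so "equality holds" is read as "equality holds for some nonzero eigenvalue of G"; for trees of diameter 1, 2 or 3 equality is still shown for every nonzero eigenvalue λ. *)

theory Defs
  imports "Jordan_Normal_Form.Char_Poly"
begin

record 'a ugraph =
  verts :: "'a set"
  edges :: "'a set set"

definition simple_graph :: "'a ugraph \<Rightarrow> bool" where
  "simple_graph G \<longleftrightarrow> finite (verts G) \<and> (\<forall>e\<in>edges G. e \<subseteq> verts G \<and> card e = 2)"

definition adj_rel :: "'a ugraph \<Rightarrow> ('a \<times> 'a) set" where
  "adj_rel G = {(u, v). {u, v} \<in> edges G}"

definition graph_components :: "'a ugraph \<Rightarrow> 'a set set" where
  "graph_components G = (\<lambda>u. {v \<in> verts G. (u, v) \<in> (adj_rel G)\<^sup>*}) ` verts G"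

definition connected_graph :: "'a ugraph \<Rightarrow> bool" where
  "connected_graph G \<longleftrightarrow>
     verts G \<noteq> {} \<and> (\<forall>u\<in>verts G. \<forall>v\<in>verts G. (u, v) \<in> (adj_rel G)\<^sup>*)"

definition cyclomatic_number :: "'a ugraph \<Rightarrow> int" where
  "cyclomatic_number G =
     int (card (edges G)) - int (card (verts G)) + int (card (graph_components G))"

(* A matrix needs its rows in some order; a different order gives a matrix that is similar
   by a permutation, so eigenvalues and their multiplicities do not depend on the choice. *)
definition vertex_list :: "'a ugraph \<Rightarrow> 'a list" where
  "vertex_list G = (SOME vs. distinct vs \<and> set vs = verts G)"

definition adj_matrix :: "'a ugraph \<Rightarrow> real mat" where
  "adj_matrix G = mat (card (verts G)) (card (verts G))
     (\<lambda>(i, j). if {vertex_list G ! i, vertex_list G ! j} \<in> edges G then 1 else 0)"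

(* Algebraic multiplicity. Since the adjacency matrix is real symmetric, all eigenvalues are
   real and this equals the dimension of the eigenspace. *)
definition eigenvalue_mult :: "'a ugraph \<Rightarrow> real \<Rightarrow> nat" where
  "eigenvalue_mult G x = Polynomial.order x (char_poly (adj_matrix G))"

definition is_matching :: "'a ugraph \<Rightarrow> 'a set set \<Rightarrow> bool" where
  "is_matching G M \<longleftrightarrow> M \<subseteq> edges G \<and> (\<forall>e\<in>M. \<forall>f\<in>M. e \<noteq> f \<longrightarrow> e \<inter> f = {})"

definition is_induced_matching :: "'a ugraph \<Rightarrow> 'a set set \<Rightarrow> bool" where
  "is_induced_matching G M \<longleftrightarrow> is_matching G M \<and>
     (\<forall>e\<in>M. \<forall>f\<in>M. e \<noteq> f \<longrightarrow> \<not> (\<exists>u\<in>e. \<exists>v\<in>f. {u, v} \<in> edges G))"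

definition induced_matching_number :: "'a ugraph \<Rightarrow> nat" where
  "induced_matching_number G = Max (card ` {M. is_induced_matching G M})"

definition graph_iso :: "'a ugraph \<Rightarrow> 'b ugraph \<Rightarrow> bool" where
  "graph_iso G H \<longleftrightarrow> (\<exists>f. bij_betw f (verts G) (verts H) \<and>
     (\<forall>u\<in>verts G. \<forall>v\<in>verts G. {u, v} \<in> edges G \<longleftrightarrow> {f u, f v} \<in> edges H))"

(* Meaningful for n >= 3. *)
definition cycle_graph :: "nat \<Rightarrow> nat ugraph" where
  "cycle_graph n = \<lparr>verts = {..<n}, edges = (\<lambda>i. {i, (i + 1) mod n}) ` {..<n}\<rparr>"

(* C_3(a,a,a): the vertices (i, 0) form the triangle, and (i, j) with 1 <= j <= a are the
   pendant vertices attached to (i, 0). *)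
definition C3_pendant :: "nat \<Rightarrow> (nat \<times> nat) ugraph" where
  "C3_pendant a =
     \<lparr>verts = {..<3} \<times> {..a},
      edges = (\<lambda>e. (\<lambda>i. (i, 0)) ` e) ` edges (cycle_graph 3)
              \<union> {{(i, 0), (i, j)} | i j. i < 3 \<and> 1 \<le> j \<and> j \<le> a}\<rparr>"

definition is_cycle :: "'a ugraph \<Rightarrow> 'a list \<Rightarrow> bool" where
  "is_cycle G vs \<longleftrightarrow> 3 \<le> length vs \<and> distinct vs \<and>
     (\<forall>i<length vs. {vs ! i, vs ! ((i + 1) mod length vs)} \<in> edges G)"

definition is_tree :: "'a ugraph \<Rightarrow> bool" where
  "is_tree G \<longleftrightarrow> connected_graph G \<and> (\<forall>vs. \<not> is_cycle G vs)"

(* Distance and diameter are meaningful for connected graphs only. *)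
definition graph_dist :: "'a ugraph \<Rightarrow> 'a \<Rightarrow> 'a \<Rightarrow> nat" where
  "graph_dist G u v = (LEAST n. (u, v) \<in> adj_rel G ^^ n)"

definition graph_diameter :: "'a ugraph \<Rightarrow> nat" where
  "graph_diameter G = Max ((\<lambda>(u, v). graph_dist G u v) ` (verts G \<times> verts G))"

end

theory Submission
  imports Defs "Jordan_Normal_Form.Spectral_Radius" "Jordan_Normal_Form.Jordan_Normal_Form_Uniqueness"
    "HOL-Library.Function_Algebras"
begin

text \<open>
  Since \<open>x \<noteq> 0\<close>, an eigenfunction vanishing at a vertex \<open>v\<close> all of whose neighbours but one are leaves
  vanishes on the closed neighbourhood of \<open>v\<close>. Deleting this neighbourhood lowers the multiplicity by at
  most one and the induced matching number by at least one. Deleting a vertex on a cycle lowers the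
  multiplicity by at most one and the cyclomatic number by at least one. This gives the inequality.

  If equality holds, it is inherited by these vertex-deleted subgraphs, and every non-isolated
  vertex supports some eigenfunction. If a vertex \<open>x\<close> on a cycle is deleted, every eigenfunction of the rest
  sums to zero over the neighbours of \<open>x\<close>; cutting eigenfunctions down to components, one sees that \<open>x\<close> has
  exactly two neighbours which are not leaves, and these lie on cycles again. So a connected extremal
  graph with a cycle is a cycle with pendant vertices. There the multiplicity is at most two, so two
  independent edges at distance at least two cannot exist, which leaves cycle lengths 3, 4 and 5;
  comparing the equations at the cycle vertices settles these. Without cycles, the same argument at \<open>v\<close> shows
  that all vertices are within distance one of an edge.
\<close>

section \<open>Multiplicity as the dimension of a space of functions\<close>

text \<open>All invariants are taken for the subgraph induced on a vertex set \<open>S\<close> of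
  one fixed graph, and functions are extended by zero outside \<open>S\<close>. Eigenspaces of
  different subgraphs then lie in one function space, and an eigenfunction of \<open>S\<close>
  vanishing on the deleted vertices is literally an eigenfunction of the rest. The converse fails in
  general; in the extremal case the dimensions agree, so the two spaces are equal as sets, and
  eigenfunctions of the rest also satisfy the equations of \<open>S\<close> at the deleted vertices.
  All structural information comes from these extra equations. To exploit them, some eigenfunction
  must be nonzero at a prescribed neighbour of a deleted vertex: restricted to a component that
  contains no other neighbour, it violates the extra equation. This is why nonvanishing at
  non-isolated vertices has to be proved before any structure. In the cyclic families equality
  depends on the eigenvalue \<open>y\<close>. Functions on the triangle with sum zero lead to
  \<open>y * y + y = a\<close>, and the golden-ratio eigenvalues of the pentagon satisfy
  \<open>y * y + y = 1\<close>; only the tree case is uniform in the eigenvalue.\<close>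

text \<open>Eigenfunctions are taken complex-valued, although all eigenvalues are real, because the Jordan normal
  form, which links the algebraic multiplicity with the dimension, exists over the complex numbers.\<close>

interpretation fvs: vector_space "\<lambda>(c::complex) (f::'a \<Rightarrow> complex) x. c * f x"
  by unfold_locales (auto simp: algebra_simps fun_eq_iff)

lemma fvs_subspaceI:
  assumes "\<And>f g c. f \<in> E \<Longrightarrow> g \<in> E \<Longrightarrow> (\<lambda>x. c * f x + g x) \<in> E" and "(\<lambda>_. 0) \<in> E"
  shows "fvs.subspace E"
proof -
  have "f + g \<in> E" if "f \<in> E" "g \<in> E" for f g
    using assms(1)[OF that, of 1] by (simp add: plus_fun_def)
  moreover have "(\<lambda>x. c * f x) \<in> E" if "f \<in> E" for f c
    using assms(1)[OF that assms(2), of c] by simp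
  ultimately show ?thesis using assms(2) by (auto simp: fvs.subspace_def zero_fun_def)
qed

lemma fvs_subspace_zero: "fvs.subspace E \<Longrightarrow> (\<lambda>_. 0) \<in> E"
  using fvs.subspace_0[of E] by (simp add: zero_fun_def)

lemma fvs_subspace_vanishing:
  assumes "fvs.subspace E"
  shows "fvs.subspace {g \<in> E. g u = 0}"
proof -
  have "fvs.subspace {g. g u = 0}" by (rule fvs_subspaceI) auto
  from fvs.subspace_inter[OF assms this] show ?thesis by (simp add: Int_def)
qed

definition supported :: "'a set \<Rightarrow> ('a \<Rightarrow> complex) set" where
  "supported S = {f. \<forall>u. u \<notin> S \<longrightarrow> f u = 0}"

lemma subspace_supported: "fvs.subspace (supported S)"
  by (rule fvs_subspaceI) (auto simp: supported_def)

lemma supported_finite_span: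
  assumes "finite S"
  shows "supported S \<subseteq> fvs.span ((\<lambda>u v. if v = u then 1 else 0) ` S)"
proof
  fix f :: "'a \<Rightarrow> complex" assume f: "f \<in> supported S"
  let ?d = "\<lambda>u v. if v = u then 1 else (0::complex)"
  have "f = (\<Sum>u\<in>S. (\<lambda>v. f u * ?d u v))"
  proof
    fix v
    have "(\<Sum>u\<in>S. (\<lambda>v. f u * ?d u v)) v = (\<Sum>u\<in>S. f u * ?d u v)"
      using assms by (induction S rule: finite_induct) (auto simp: plus_fun_def zero_fun_def)
    also have "\<dots> = f v" using assms f by (auto simp: supported_def if_distrib cong: if_cong)
    finally show "f v = (\<Sum>u\<in>S. (\<lambda>v. f u * ?d u v)) v" ..
  qed
  moreover have "(\<Sum>u\<in>S. (\<lambda>v. f u * ?d u v)) \<in> fvs.span (?d ` S)"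
    by (intro fvs.span_sum fvs.span_scale fvs.span_base) auto
  ultimately show "f \<in> fvs.span (?d ` S)" by (rule ssubst[where P = "\<lambda>g. g \<in> fvs.span (?d ` S)"])
qed

text \<open>The full function space is infinite-dimensional when \<open>'a\<close> is infinite;
  support in the finite set \<open>S\<close> is what makes bases finite and \<open>fvs.dim\<close>
  meaningful.\<close>

lemma fvs_independent_finite:
  assumes "finite S" "fvs.independent B" "B \<subseteq> supported S"
  shows "finite B"
  using fvs.independent_span_bound[OF _ assms(2)] supported_finite_span[OF assms(1)] assms(1,3)
  by (meson finite_imageI subset_trans)

lemma fvs_basis:
  assumes "finite S" "E \<subseteq> supported S" "fvs.subspace E"
  obtains B where "finite B" "fvs.independent B" "B \<subseteq> E" "fvs.span B = E" "card B = fvs.dim E"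
proof -
  obtain B where B: "B \<subseteq> E" "fvs.independent B" "E \<subseteq> fvs.span B" "card B = fvs.dim E"
    by (rule fvs.basis_exists)
  have "finite B" by (rule fvs_independent_finite[OF assms(1) B(2) subset_trans[OF B(1) assms(2)]])
  moreover have "fvs.span B = E" using fvs.span_minimal[OF B(1) assms(3)] B(3) by (rule subset_antisym)
  ultimately show thesis using B that by blast
qed

lemma fvs_dim_mono:
  assumes "finite S" "F \<subseteq> supported S" "fvs.subspace F" "E \<subseteq> F"
  shows "fvs.dim E \<le> fvs.dim F"
proof -
  obtain B where B: "finite B" "fvs.span B = F" "card B = fvs.dim F"
    using fvs_basis[OF assms(1-3)] by blast
  then show ?thesis using fvs.dim_le_card[of E B] assms(4) by simp
qed

lemma fvs_dim_eq:
  assumes S: "finite S" "F \<subseteq> supported S" and E: "fvs.subspace E" and F: "fvs.subspace F"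
    and "E \<subseteq> F" and d: "fvs.dim F \<le> fvs.dim E"
  shows "E = F"
proof (rule ccontr)
  assume "E \<noteq> F"
  obtain B where B: "finite B" "fvs.independent B" "B \<subseteq> E" "fvs.span B = E" "card B = fvs.dim E"
    using fvs_basis[OF S(1) _ E] S(2) \<open>E \<subseteq> F\<close> by blast
  obtain f where f: "f \<in> F" "f \<notin> fvs.span B" using B(4) \<open>E \<noteq> F\<close> \<open>E \<subseteq> F\<close> by blast
  have i: "fvs.independent (insert f B)" using B(2) f(2) by (simp add: fvs.independent_insert)
  have "insert f B \<subseteq> F" using f B(3) \<open>E \<subseteq> F\<close> by auto
  obtain C where C: "finite C" "C \<subseteq> F" "fvs.span C = F" "card C = fvs.dim F"
    using fvs_basis[OF S F] by blast
  have "card (insert f B) \<le> card C"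
    using fvs.independent_span_bound[OF C(1) i] C(3) \<open>insert f B \<subseteq> F\<close> by simp
  moreover have "f \<notin> B" using f(2) by (auto intro: fvs.span_base)
  ultimately show False using B(1,5) C(4) d by simp
qed

text \<open>Rank-nullity for evaluation at \<open>u\<close>: subtracting the multiple
  \<open>g u / f u\<close> of \<open>f\<close> moves any \<open>g\<close> into the kernel, so
  \<open>f\<close> completes a basis of the kernel to a basis of \<open>E\<close>.\<close>

lemma fvs_dim_vanishing:
  fixes E :: "('a \<Rightarrow> complex) set"
  assumes S: "finite S" "E \<subseteq> supported S" and E: "fvs.subspace E"
    and f: "f \<in> E" "f u \<noteq> 0"
  shows "fvs.dim E = Suc (fvs.dim {g \<in> E. g u = 0})"
proof -
  let ?E = "{g \<in> E. g u = 0}"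
  have sub: "fvs.subspace ?E" by (rule fvs_subspace_vanishing[OF E])
  obtain B where B: "finite B" "fvs.independent B" "B \<subseteq> ?E" "fvs.span B = ?E" "card B = fvs.dim ?E"
    using fvs_basis[OF S(1) _ sub] S(2) by blast
  have fB: "f \<notin> fvs.span B" using f B(4) by simp
  have i: "fvs.independent (insert f B)" using B(2) fB by (simp add: fvs.independent_insert)
  have "E \<subseteq> fvs.span (insert f B)"
  proof
    fix g assume g: "g \<in> E"
    have "g - (\<lambda>x. g u / f u * f x) \<in> E"
      by (rule fvs.subspace_diff[OF E g fvs.subspace_scale[OF E f(1)]])
    then have "g - (\<lambda>x. g u / f u * f x) \<in> ?E" using f(2) by simp
    then show "g \<in> fvs.span (insert f B)" unfolding fvs.span_insert using B(4) by blast
  qed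
  then have "fvs.dim E = card (insert f B)"
    using fvs.basis_card_eq_dim[of "insert f B" E] i f(1) B(3)
    by (metis (no_types, lifting) insert_subset mem_Collect_eq subset_iff)
  moreover have "f \<notin> B" using fB by (auto intro: fvs.span_base)
  ultimately show ?thesis using B by simp
qed

lemma fvs_dim_le_Suc_vanishing:
  fixes E :: "('a \<Rightarrow> complex) set"
  assumes S: "finite S" "E \<subseteq> supported S" and E: "fvs.subspace E"
  shows "fvs.dim E \<le> Suc (fvs.dim {g \<in> E. g u = 0})"
proof (cases "\<exists>f\<in>E. f u \<noteq> 0")
  case True
  then show ?thesis using fvs_dim_vanishing[OF assms] by auto
next
  case False
  then have "{g \<in> E. g u = 0} = E" by auto
  then show ?thesis by simp
qed

lemma fvs_dim_zero: "fvs.dim {\<lambda>_. 0} = 0"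
  using fvs.dim_le_card[of "{\<lambda>_. 0}" "{}"] by (simp add: zero_fun_def)


section \<open>Algebraic multiplicity as a kernel dimension\<close>

lemma fvs_dim_eq_kernel_dim:
  fixes M :: "complex mat"
  assumes M: "M \<in> carrier_mat n n" and vs: "distinct vs" "length vs = n"
  shows "fvs.dim {f \<in> supported (set vs). \<forall>i<n. (\<Sum>j<n. M $$ (i, j) * f (vs ! j)) = 0} = kernel_dim M"
    (is "fvs.dim ?E = _")
proof -
  interpret K: kernel n n M by unfold_locales (rule M)
  obtain B where B: "finite B" "K.basis B" using kernel_basis_exists[OF M] by blast
  then have Bk: "B \<subseteq> mat_kernel M" and Bi: "\<not> K.lin_dep B" and Bs: "K.span B = mat_kernel M"
    unfolding K.Ker.basis_def by auto
  \<comment> \<open>\<open>p w\<close> reads the vector \<open>w\<close> as a function on the listed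
    points, extended by zero; it carries a basis of the kernel to a basis of
    \<open>?E\<close>.\<close>
  define p where "p w u = (if u \<in> set vs then w $ (THE j. j < n \<and> vs ! j = u) else 0)"
    for w :: "complex vec" and u
  have p: "p w (vs ! j) = w $ j" if "j < n" for w j
  proof -
    have "(THE j'. j' < n \<and> vs ! j' = vs ! j) = j"
      using that vs by (intro the_equality) (auto simp: nth_eq_iff_index_eq)
    then show ?thesis using that vs by (simp add: p_def)
  qed
  have p_supp: "p w \<in> supported (set vs)" for w by (simp add: supported_def p_def)
  have ext: "f = g" if "f \<in> supported (set vs)" "g \<in> supported (set vs)"
    "\<And>j. j < n \<Longrightarrow> f (vs ! j) = g (vs ! j)" for f g
    using that vs(2) by (auto simp: supported_def fun_eq_iff in_set_conv_nth) (metis in_set_conv_nth)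
  have ker: "w \<in> mat_kernel M \<longleftrightarrow> w \<in> carrier_vec n \<and> (\<forall>i<n. (\<Sum>j<n. M $$ (i, j) * w $ j) = 0)" for w
    unfolding mat_kernel[OF M] using M
    by (auto simp: vec_eq_iff scalar_prod_def atLeast0LessThan)
  have inj: "inj_on p B"
  proof (rule inj_onI)
    fix w w' assume "w \<in> B" "w' \<in> B" "p w = p w'"
    then show "w = w'" using Bk ker p by (intro eq_vecI) (metis carrier_vecD subsetD)+
  qed
  have sum_p: "(\<Sum>w\<in>B. (\<lambda>u. a w * p w u)) (vs ! j) = K.lincomb a B $ j" if "j < n" for a j
  proof -
    have "(\<Sum>w\<in>B. (\<lambda>u. a w * p w u)) (vs ! j) = (\<Sum>w\<in>B. a w * p w (vs ! j))"
      using B(1) by (induction B rule: finite_induct) (auto simp: plus_fun_def zero_fun_def)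
    then show ?thesis using K.lincomb_index[OF that Bk] p[OF that] by simp
  qed
  have sum_supp: "(\<Sum>w\<in>B. (\<lambda>u. a w * p w u)) \<in> supported (set vs)" for a
    using p_supp by (intro fvs.subspace_sum subspace_supported fvs.subspace_scale)
  have "fvs.dim ?E = card (p ` B)"
  proof (rule fvs.dim_unique[OF _ _ _ refl])
    have "(\<Sum>j<n. M $$ (i, j) * p w (vs ! j)) = (\<Sum>j<n. M $$ (i, j) * w $ j)" for w i
      by (intro sum.cong) (simp_all add: p)
    then show "p ` B \<subseteq> ?E" using p_supp Bk ker by auto
    show "?E \<subseteq> fvs.span (p ` B)"
    proof
      fix f assume f: "f \<in> ?E"
      define w where "w = vec n (\<lambda>j. f (vs ! j))"
      have "w \<in> K.span B" unfolding Bs ker using f by (simp add: w_def)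
      then obtain a where a: "K.lincomb a B = w" using K.Ker.finite_in_span[OF B(1)] Bk by blast
      have "f = (\<Sum>w\<in>B. (\<lambda>u. a w * p w u))"
        by (rule ext) (use f sum_supp in \<open>auto simp: sum_p a w_def\<close>)
      moreover have "(\<Sum>w\<in>B. (\<lambda>u. a w * p w u)) \<in> fvs.span (p ` B)"
        by (intro fvs.span_sum fvs.span_scale fvs.span_base) auto
      ultimately show "f \<in> fvs.span (p ` B)"
        by (rule ssubst[where P = "\<lambda>g. g \<in> fvs.span (p ` B)"])
    qed
    show "fvs.independent (p ` B)"
    proof
      assume "fvs.dependent (p ` B)"
      then obtain c where c: "\<exists>v\<in>p ` B. c v \<noteq> 0" "(\<Sum>v\<in>p ` B. (\<lambda>x. c v * v x)) = 0"
        using fvs.dependent_finite[of "p ` B"] B(1) by auto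
      have z: "(\<Sum>w\<in>B. (\<lambda>u. c (p w) * p w u)) = 0"
        using c(2) by (simp add: sum.reindex[OF inj])
      have "K.lincomb (c \<circ> p) B = 0\<^sub>v n"
      proof (rule eq_vecI)
        have "K.lincomb (c \<circ> p) B \<in> mat_kernel M"
          using Bk by (intro K.Ker.lincomb_closed) auto
        then show "dim_vec (K.lincomb (c \<circ> p) B) = dim_vec (0\<^sub>v n)" using ker by auto
        show "K.lincomb (c \<circ> p) B $ j = 0\<^sub>v n $ j" if "j < dim_vec (0\<^sub>v n)" for j
          using sum_p[of j "c \<circ> p"] that by (simp add: z)
      qed
      then have "K.lin_dep B"
        unfolding K.Ker.lin_dep_def using B(1) c(1) by fastforce
      then show False using Bi by contradiction
    qed
  qed
  also have "\<dots> = card B" using inj by (rule card_image)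
  also have "\<dots> = kernel_dim M" using K.Ker.dim_basis[OF B] by simp
  finally show ?thesis .
qed

text \<open>\<open>C\<close> is Hermitian: if \<open>w = C v\<close> and \<open>C w = 0\<close>,
  moving \<open>C\<close> across the inner product shows that the squared norm of \<open>w\<close>
  is zero. This will exclude Jordan blocks larger than one.\<close>

lemma mat_kernel_sq_of_real_symmetric:
  fixes C :: "complex mat"
  assumes C: "C \<in> carrier_mat n n"
    and sym: "\<And>i j. i < n \<Longrightarrow> j < n \<Longrightarrow> C $$ (i, j) = C $$ (j, i)"
    and real: "\<And>i j. i < n \<Longrightarrow> j < n \<Longrightarrow> cnj (C $$ (i, j)) = C $$ (i, j)"
  shows "mat_kernel (C * C) = mat_kernel C"
proof
  show "mat_kernel C \<subseteq> mat_kernel (C * C)" by (rule mat_kernel_mult_subset[OF C C])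
  show "mat_kernel (C * C) \<subseteq> mat_kernel C"
  proof
    fix v assume "v \<in> mat_kernel (C * C)"
    then have v: "v \<in> carrier_vec n" "C * C *\<^sub>v v = 0\<^sub>v n"
      using mat_kernelD[of "C * C" n n] C by auto
    define w where "w = C *\<^sub>v v"
    have w: "w \<in> carrier_vec n" using C v by (simp add: w_def)
    have wi: "w $ i = (\<Sum>j<n. C $$ (i, j) * v $ j)" if "i < n" for i
      using that C v by (simp add: w_def scalar_prod_def atLeast0LessThan)
    have "C *\<^sub>v w = 0\<^sub>v n" using v C by (simp add: w_def)
    then have Cw: "(\<Sum>j<n. C $$ (i, j) * w $ j) = 0" if "i < n" for i
      using that C w by (auto simp: vec_eq_iff scalar_prod_def atLeast0LessThan)
    have "(\<Sum>j<n. cnj (w $ j) * w $ j) = (\<Sum>j<n. \<Sum>i<n. C $$ (i, j) * cnj (v $ i) * w $ j)"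
      by (intro sum.cong refl) (simp add: wi sum_distrib_right real sym[symmetric])
    also have "\<dots> = (\<Sum>i<n. cnj (v $ i) * (\<Sum>j<n. C $$ (i, j) * w $ j))"
      by (subst sum.swap) (simp add: sum_distrib_left mult_ac)
    also have "\<dots> = 0" by (simp add: Cw)
    finally have "(\<Sum>j<n. complex_of_real ((cmod (w $ j))\<^sup>2)) = 0"
      by (simp only: complex_norm_square mult.commute[of "cnj _"])
    then have "(\<Sum>j<n. (cmod (w $ j))\<^sup>2) = 0" by (metis of_real_eq_0_iff of_real_sum)
    then have "w $ j = 0" if "j < n" for j
      using that by (subst (asm) sum_nonneg_eq_0_iff) auto
    then have "w = 0\<^sub>v n" using w by (intro eq_vecI) auto
    then show "v \<in> mat_kernel C" using C v by (intro mat_kernelI) (auto simp: w_def)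
  qed
qed

lemma kernel_dim_cong:
  fixes A B :: "'a::field mat"
  assumes "mat_kernel A = mat_kernel B" "dim_col A = dim_col B"
  shows "kernel_dim A = kernel_dim B"
  unfolding kernel_dim_def assms ..

text \<open>\<open>ks\<close> stands for the Jordan block sizes of one eigenvalue; the two sums are
  the kernel dimensions of the second and first power. Their agreement forces every block size to be
  at most one.\<close>

lemma sum_list_min_eq:
  fixes ks :: "nat list"
  assumes "(\<Sum>k\<leftarrow>ks. min 2 k) = (\<Sum>k\<leftarrow>ks. min 1 k)"
  shows "sum_list ks = (\<Sum>k\<leftarrow>ks. min 1 k)"
  using assms
proof (induction ks)
  case (Cons k ks)
  have "(\<Sum>m\<leftarrow>ks. min 1 m) \<le> (\<Sum>m\<leftarrow>ks. min 2 m)" by (intro sum_list_mono) auto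
  moreover have "min 1 k \<le> min 2 k" by simp
  ultimately have "min 2 k = min 1 k" "(\<Sum>m\<leftarrow>ks. min 2 m) = (\<Sum>m\<leftarrow>ks. min 1 m)"
    using Cons.prems by (simp_all only: list.map sum_list.Cons)
  then show ?case using Cons.IH by (simp add: min_def split: if_splits)
qed simp

text \<open>The characteristic matrix and its square have the same kernel, so all Jordan blocks at
  \<open>x\<close> have size at most one and contribute equally to the algebraic multiplicity and to
  the kernel dimension.\<close>

lemma order_char_poly_real_symmetric:
  fixes A :: "real mat"
  assumes A: "A \<in> carrier_mat n n"
    and sym: "\<And>i j. i < n \<Longrightarrow> j < n \<Longrightarrow> A $$ (i, j) = A $$ (j, i)"
  shows "Polynomial.order x (char_poly A)
    = kernel_dim (char_matrix (map_mat complex_of_real A) (complex_of_real x))"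
proof -
  interpret hom: map_poly_inj_idom_divide_hom complex_of_real ..
  let ?A = "map_mat complex_of_real A" and ?x = "complex_of_real x"
  let ?C = "char_matrix ?A ?x"
  have cA: "?A \<in> carrier_mat n n" using A by simp
  have C: "?C \<in> carrier_mat n n" using cA by simp
  obtain n_as where jnf: "jordan_nf ?A n_as"
    using char_poly_factorized[OF cA] jordan_nf_exists[OF cA] by blast
  define ns where "ns = map fst [(m, e)\<leftarrow>n_as. e = ?x]"
  have "mat_kernel (?C * ?C) = mat_kernel ?C"
    by (rule mat_kernel_sq_of_real_symmetric[OF C]) (use A sym in \<open>auto simp: char_matrix_def\<close>)
  then have "kernel_dim (?C * ?C) = kernel_dim ?C" using C by (intro kernel_dim_cong) auto
  then have "dim_gen_eigenspace ?A ?x 2 = dim_gen_eigenspace ?A ?x 1"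
    using C by (simp add: dim_gen_eigenspace_def numeral_2_eq_2)
  then have "(\<Sum>m\<leftarrow>ns. min 2 m) = (\<Sum>m\<leftarrow>ns. min 1 m)"
    by (simp add: dim_gen_eigenspace[OF jnf] ns_def)
  from sum_list_min_eq[OF this]
  have "dim_gen_eigenspace ?A ?x 1 = sum_list ns"
    by (simp add: dim_gen_eigenspace[OF jnf] ns_def)
  also have "sum_list ns = Polynomial.order ?x (char_poly ?A)"
    unfolding jordan_nf_order[OF jnf] ns_def by (simp add: case_prod_unfold)
  also have "Polynomial.order ?x (char_poly ?A) = Polynomial.order x (char_poly A)"
    unfolding of_real_hom.char_poly_hom[OF A] by (rule hom.order_hom)
  finally show ?thesis using C by (simp add: dim_gen_eigenspace_def)
qed

section \<open>Vertex-deleted subgraphs and their invariants\<close>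

locale sgraph =
  fixes G :: "'a ugraph"
  assumes simple: "simple_graph G"
begin

lemma finite_verts: "finite (verts G)"
  and edge_subset: "e \<in> edges G \<Longrightarrow> e \<subseteq> verts G"
  and card_edge: "e \<in> edges G \<Longrightarrow> card e = 2"
  using simple by (auto simp: simple_graph_def)

lemma finite_edges: "finite (edges G)"
proof (rule finite_subset)
  show "edges G \<subseteq> Pow (verts G)" using edge_subset by blast
qed (simp add: finite_verts)

lemma no_loop [simp]: "{u} \<notin> edges G"
  using card_edge by fastforce

lemma adj_neq: "{u, v} \<in> edges G \<Longrightarrow> u \<noteq> v"
  by auto

lemma adj_commute: "{u, v} \<in> edges G \<longleftrightarrow> {v, u} \<in> edges G"
  by (simp add: insert_commute)

section \<open>Neighbourhoods, reachability and the cyclomatic number inside a vertex set\<close>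

definition nb :: "'a set \<Rightarrow> 'a \<Rightarrow> 'a set" where
  "nb S u = {v \<in> S. {u, v} \<in> edges G}"

lemma nb_iff: "v \<in> nb S u \<longleftrightarrow> v \<in> S \<and> {u, v} \<in> edges G"
  by (simp add: nb_def)

lemma finite_nb [simp]: "finite S \<Longrightarrow> finite (nb S u)"
  by (simp add: nb_def)

lemma nb_sym: "v \<in> nb S u \<Longrightarrow> u \<in> S \<Longrightarrow> u \<in> nb S v"
  by (auto simp: nb_def adj_commute)

lemma nb_irrefl [simp]: "u \<notin> nb S u"
  by (simp add: nb_def)

lemma nb_Diff: "nb (S - T) u = nb S u - T"
  by (auto simp: nb_def)

lemma nb_mono: "T \<subseteq> S \<Longrightarrow> nb T u \<subseteq> nb S u"
  by (auto simp: nb_def)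

definition step :: "'a set \<Rightarrow> ('a \<times> 'a) set" where
  "step S = {(a, b). a \<in> S \<and> b \<in> S \<and> {a, b} \<in> edges G}"

definition reach :: "'a set \<Rightarrow> 'a \<Rightarrow> 'a set" where
  "reach S u = {v. (u, v) \<in> (step S)\<^sup>*}"

lemma reach_refl [simp]: "u \<in> reach S u"
  by (simp add: reach_def)

lemma reach_step: "v \<in> reach S u \<Longrightarrow> v \<in> S \<Longrightarrow> w \<in> nb S v \<Longrightarrow> w \<in> reach S u"
  unfolding reach_def by (auto simp: step_def nb_def intro: rtrancl_into_rtrancl)

lemma reach_closed:
  assumes "u \<in> C" "\<And>a b. a \<in> C \<Longrightarrow> a \<in> S \<Longrightarrow> b \<in> nb S a \<Longrightarrow> b \<in> C"
  shows "reach S u \<subseteq> C"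
proof
  fix v assume "v \<in> reach S u"
  then have "(u, v) \<in> (step S)\<^sup>*" by (simp add: reach_def)
  then show "v \<in> C"
    by (induction rule: rtrancl_induct) (use assms in \<open>auto simp: step_def nb_def\<close>)
qed

lemma reach_subset: "u \<in> S \<Longrightarrow> reach S u \<subseteq> S"
  by (rule reach_closed) (auto simp: nb_def)

lemma sym_step: "sym (step S)"
  by (auto simp: sym_def step_def adj_commute)

lemma reach_sym: "v \<in> reach S u \<Longrightarrow> u \<in> reach S v"
  unfolding reach_def using sym_rtrancl[OF sym_step] by (auto simp: sym_def)

lemma reach_eq: "v \<in> reach S u \<Longrightarrow> reach S v = reach S u"
  using reach_sym[of v S u] by (auto simp: reach_def)

lemma reach_mono: "T \<subseteq> S \<Longrightarrow> reach T u \<subseteq> reach S u"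
proof -
  assume "T \<subseteq> S"
  then have "step T \<subseteq> step S" by (auto simp: step_def)
  then show ?thesis unfolding reach_def using rtrancl_mono by blast
qed

definition cyc :: "'a set \<Rightarrow> int" where
  "cyc S = int (card {e \<in> edges G. e \<subseteq> S}) - int (card S) + int (card (reach S ` S))"

text \<open>Deleting \<open>x\<close> loses one vertex and \<open>card (nb S x)\<close> edges, and
  breaks the component of \<open>x\<close> into those components of \<open>S - {x}\<close> that meet
  \<open>nb S x\<close>. The remaining components, collected in \<open>A\<close>, are
  unchanged.\<close>

lemma cyc_remove:
  assumes fin: "finite S" and x: "x \<in> S"
  shows "cyc S = cyc (S - {x}) + int (card (nb S x)) - int (card (reach (S - {x}) ` nb S x))"
proof -
  let ?T = "S - {x}" and ?N = "nb S x"
  let ?R = "reach ?T"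
  have "{e \<in> edges G. e \<subseteq> S} = {e \<in> edges G. e \<subseteq> ?T} \<union> (\<lambda>v. {x, v}) ` ?N"
  proof -
    have "e \<in> (\<lambda>v. {x, v}) ` ?N" if e: "e \<in> edges G" "e \<subseteq> S" "x \<in> e" for e
    proof -
      obtain v where "e = {x, v}"
        using card_edge[OF e(1)] e(3) by (auto simp: card_2_iff)
      then show ?thesis using e by (auto simp: nb_def)
    qed
    then show ?thesis using x by (auto simp: nb_def)
  qed
  moreover have "inj_on (\<lambda>v. {x, v}) ?N" by (auto simp: inj_on_def doubleton_eq_iff)
  moreover have "{e \<in> edges G. e \<subseteq> ?T} \<inter> (\<lambda>v. {x, v}) ` ?N = {}" by auto
  ultimately have e: "card {e \<in> edges G. e \<subseteq> S} = card {e \<in> edges G. e \<subseteq> ?T} + card ?N"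
    using finite_edges fin by (simp add: card_Un_disjoint card_image)
  have NT: "?N \<subseteq> ?T" by (auto simp: nb_def)
  define A where "A = {C \<in> ?R ` ?T. C \<inter> ?N = {}}"
  have "?R ` ?T = A \<union> ?R ` ?N"
  proof -
    have "?R u \<in> ?R ` ?N" if "?R u \<inter> ?N \<noteq> {}" for u
      using that reach_eq by (metis Int_emptyI imageI)
    then show ?thesis using NT by (auto simp: A_def)
  qed
  moreover have "A \<inter> ?R ` ?N = {}" by (auto simp: A_def)
  moreover have finA: "finite A" using fin by (simp add: A_def)
  ultimately have cT: "card (?R ` ?T) = card A + card (?R ` ?N)"
    using fin by (metis card_Un_disjoint finite_imageI finite_nb)
  have far: "reach S u = ?R u" if u: "u \<in> ?T" "?R u \<inter> ?N = {}" for u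
  proof
    show "?R u \<subseteq> reach S u" by (rule reach_mono) auto
    show "reach S u \<subseteq> ?R u"
    proof (rule reach_closed)
      fix a b assume a: "a \<in> ?R u" "b \<in> nb S a"
      then have aT: "a \<in> ?T" using reach_subset[OF u(1)] by blast
      have "b \<noteq> x" using a u(2) aT nb_sym[of x S a] by blast
      then show "b \<in> ?R u" using a aT by (intro reach_step[OF a(1) aT]) (auto simp: nb_def)
    qed simp
  qed
  have near: "reach S u = reach S x" if u: "u \<in> ?T" "?R u \<inter> ?N \<noteq> {}" for u
  proof -
    obtain y where y: "y \<in> ?R u" "y \<in> ?N" using u(2) by blast
    then have "y \<in> reach S u" using reach_mono[of ?T S u] by blast
    then have "x \<in> reach S u" by (rule reach_step) (use y(2) x in \<open>auto simp: nb_def adj_commute\<close>)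
    then show ?thesis by (simp add: reach_eq)
  qed
  have "reach S ` S = insert (reach S x) A"
  proof
    show "reach S ` S \<subseteq> insert (reach S x) A"
    proof (rule image_subsetI)
      fix u assume u: "u \<in> S"
      consider "u = x" | "u \<in> ?T" "?R u \<inter> ?N = {}" | "u \<in> ?T" "?R u \<inter> ?N \<noteq> {}" using u by blast
      then show "reach S u \<in> insert (reach S x) A"
      proof cases
        case 2
        then have "?R u \<in> A" unfolding A_def by blast
        then show ?thesis using far[OF 2] by simp
      qed (simp_all add: near)
    qed
    show "insert (reach S x) A \<subseteq> reach S ` S"
    proof
      fix C assume "C \<in> insert (reach S x) A"
      then consider "C = reach S x" | u where "u \<in> ?T" "C = ?R u" "?R u \<inter> ?N = {}"
        by (auto simp: A_def)
      then show "C \<in> reach S ` S"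
      proof cases
        case 2
        then show ?thesis using far[OF 2(1,3)] by blast
      qed (use x in blast)
    qed
  qed
  moreover have "reach S x \<notin> A"
  proof
    assume "reach S x \<in> A"
    then obtain u where "u \<in> ?T" "reach S x = ?R u" by (auto simp: A_def)
    then show False using reach_subset[of u ?T] reach_refl[of x S] by blast
  qed
  ultimately have cS: "card (reach S ` S) = Suc (card A)" using finA by simp
  have "card S = Suc (card ?T)" using fin x by (metis card_Suc_Diff1)
  with e cT cS show ?thesis by (simp add: cyc_def)
qed

lemma cyc_remove_le:
  assumes "finite S" "x \<in> S"
  shows "cyc (S - {x}) \<le> cyc S"
  using cyc_remove[OF assms] card_image_le[of "nb S x" "reach (S - {x})"] assms(1) by simp

text \<open>\<open>x\<close> lies on a cycle, phrased through reachability. In this form it is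
  exactly the failure of injectivity that makes the correction term of \<open>cyc_remove\<close>
  positive.\<close>

definition cyclic :: "'a set \<Rightarrow> 'a \<Rightarrow> bool" where
  "cyclic S x \<longleftrightarrow> (\<exists>y\<in>nb S x. \<exists>z\<in>nb S x. y \<noteq> z \<and> z \<in> reach (S - {x}) y)"

lemma cyclic_iff_not_inj: "cyclic S x \<longleftrightarrow> \<not> inj_on (reach (S - {x})) (nb S x)"
  unfolding cyclic_def inj_on_def using reach_eq reach_refl by metis

lemma cyc_remove_cyclic:
  assumes "finite S" "x \<in> S" "cyclic S x"
  shows "cyc (S - {x}) + 1 \<le> cyc S"
  using cyc_remove[OF assms(1,2)] card_image_le[of "nb S x" "reach (S - {x})"] assms
    inj_on_iff_eq_card[of "nb S x" "reach (S - {x})"] by (simp add: cyclic_iff_not_inj)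

lemma cyc_remove_not_cyclic:
  assumes "finite S" "x \<in> S" "\<not> cyclic S x"
  shows "cyc (S - {x}) = cyc S"
  using cyc_remove[OF assms(1,2)] assms(3) by (simp add: cyclic_iff_not_inj card_image)

lemma cyclic_mono: "T \<subseteq> S \<Longrightarrow> cyclic T x \<Longrightarrow> cyclic S x"
  unfolding cyclic_def using nb_mono[of T S] reach_mono[of "T - {x}" "S - {x}"]
  by (meson Diff_mono subset_refl subsetD)

lemma cyc_empty: "cyc {} = 0"
  using card_edge[of "{}"] by (auto simp: cyc_def)

lemma cyc_nonneg: "finite S \<Longrightarrow> 0 \<le> cyc S"
proof (induction S rule: finite_induct)
  case (insert x S)
  then show ?case using cyc_remove_le[of "insert x S" x] by simp
qed (simp add: cyc_empty)

lemma cyc_acyclic: "finite S \<Longrightarrow> (\<And>x. x \<in> S \<Longrightarrow> \<not> cyclic S x) \<Longrightarrow> cyc S = 0"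
proof (induction S rule: finite_induct)
  case (insert x S)
  have "cyc S = 0" using insert.prems cyclic_mono[of S "insert x S"] by (intro insert.IH) auto
  then show ?case using cyc_remove_not_cyclic[of "insert x S" x] insert by simp
qed (simp add: cyc_empty)

section \<open>Induced matchings inside a vertex set\<close>

definition imatch :: "'a set \<Rightarrow> 'a set set \<Rightarrow> bool" where
  "imatch S M \<longleftrightarrow> is_induced_matching G M \<and> \<Union>M \<subseteq> S"

definition imn :: "'a set \<Rightarrow> nat" where
  "imn S = Max (card ` Collect (imatch S))"

lemma imatch_edges: "imatch S M \<Longrightarrow> M \<subseteq> edges G"
  by (simp add: imatch_def is_induced_matching_def is_matching_def)

lemma finite_imatch: "finite (Collect (imatch S))"
proof (rule finite_subset)
  show "Collect (imatch S) \<subseteq> Pow (edges G)" using imatch_edges by blast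
qed (simp add: finite_edges)

lemma imatch_empty: "imatch S {}"
  by (simp add: imatch_def is_induced_matching_def is_matching_def)

lemma card_le_imn: "imatch S M \<Longrightarrow> card M \<le> imn S"
  unfolding imn_def using finite_imatch by (intro Max_ge) auto

lemma imn_obtain: obtains M where "imatch S M" "card M = imn S"
proof -
  have "imn S \<in> card ` Collect (imatch S)"
    unfolding imn_def using finite_imatch imatch_empty by (intro Max_in) auto
  then show ?thesis using that by auto
qed

lemma imn_mono: "T \<subseteq> S \<Longrightarrow> imn T \<le> imn S"
proof -
  assume "T \<subseteq> S"
  obtain M where "imatch T M" "card M = imn T" by (rule imn_obtain)
  then show ?thesis using \<open>T \<subseteq> S\<close> card_le_imn[of S M] by (auto simp: imatch_def)
qed

text \<open>Every strict comparison of \<open>imn\<close> values comes from here: nothing in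
  \<open>T\<close> touches \<open>{v, y}\<close> or is joined to it, so this edge can be added to an
  optimal induced matching of \<open>T\<close>.\<close>

lemma imn_add_edge:
  assumes vy: "{v, y} \<in> edges G" "v \<in> S" "y \<in> S" and "T \<subseteq> S"
    and T: "T \<inter> ({v, y} \<union> nb S v \<union> nb S y) = {}"
  shows "Suc (imn T) \<le> imn S"
proof -
  obtain M where M: "imatch T M" "card M = imn T" by (rule imn_obtain)
  have off: "w \<notin> {v, y}" "{v, w} \<notin> edges G" "{y, w} \<notin> edges G" "{w, v} \<notin> edges G" "{w, y} \<notin> edges G"
    if "f \<in> M" "w \<in> f" for f w
  proof -
    have w: "w \<in> T" using M(1) that by (auto simp: imatch_def)
    then have "w \<in> S" "w \<notin> {v, y}" "w \<notin> nb S v" "w \<notin> nb S y" using T \<open>T \<subseteq> S\<close> by blast+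
    then show "w \<notin> {v, y}" "{v, w} \<notin> edges G" "{y, w} \<notin> edges G" by (simp_all add: nb_iff)
    then show "{w, v} \<notin> edges G" "{w, y} \<notin> edges G" by (simp_all add: adj_commute)
  qed
  have "is_matching G (insert {v, y} M)"
    unfolding is_matching_def
  proof (intro conjI ballI impI)
    show "insert {v, y} M \<subseteq> edges G" using imatch_edges[OF M(1)] vy(1) by simp
    fix e f assume "e \<in> insert {v, y} M" "f \<in> insert {v, y} M" "e \<noteq> f"
    then consider "e \<in> M" "f \<in> M" | "e = {v, y}" "f \<in> M" | "e \<in> M" "f = {v, y}" by blast
    then show "e \<inter> f = {}"
    proof cases
      case 1
      then show ?thesis
        using M(1) \<open>e \<noteq> f\<close> by (simp add: imatch_def is_induced_matching_def is_matching_def)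
    qed (use off(1) in blast)+
  qed
  moreover have "\<not> (\<exists>u\<in>e. \<exists>w\<in>f. {u, w} \<in> edges G)"
    if ef: "e \<in> insert {v, y} M" "f \<in> insert {v, y} M" "e \<noteq> f" for e f
  proof (cases "e = {v, y} \<or> f = {v, y}")
    case True
    then consider "e = {v, y}" "f \<in> M" | "e \<in> M" "f = {v, y}" using ef by blast
    then show ?thesis by cases (use off in \<open>force+\<close>)
  next
    case False
    then show ?thesis using that M(1) by (auto simp: imatch_def is_induced_matching_def)
  qed
  ultimately have "imatch S (insert {v, y} M)"
    using M(1) vy(2,3) \<open>T \<subseteq> S\<close> by (auto simp: imatch_def is_induced_matching_def)
  moreover have "{v, y} \<notin> M" using off(1)[of "{v, y}" v] by auto
  moreover have "finite M" using imatch_edges[OF M(1)] finite_edges by (rule finite_subset)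
  ultimately show ?thesis using card_le_imn[of S "insert {v, y} M"] M(2) by simp
qed

lemma imn_pos: "{v, y} \<in> edges G \<Longrightarrow> v \<in> S \<Longrightarrow> y \<in> S \<Longrightarrow> 1 \<le> imn S"
  using imn_add_edge[of v y S "{}"] by simp

end

lemma sum_if_Int: "finite A \<Longrightarrow> (\<Sum>v\<in>A. if v \<in> C then f v else 0) = sum f (A \<inter> C)"
  by (simp add: sum.inter_restrict)

section \<open>Eigenfunctions on vertex sets\<close>

locale graph_ev = sgraph G for G :: "'a ugraph" +
  fixes lam :: complex
  assumes lam: "lam \<noteq> 0"
begin

definition eig :: "'a set \<Rightarrow> ('a \<Rightarrow> complex) set" where
  "eig S = {f \<in> supported S. \<forall>u\<in>S. lam * f u = sum f (nb S u)}"

definition mult :: "'a set \<Rightarrow> nat" where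
  "mult S = fvs.dim (eig S)"

lemma eig_supported: "eig S \<subseteq> supported S"
  by (auto simp: eig_def)

lemma eig_outside: "f \<in> eig S \<Longrightarrow> u \<notin> S \<Longrightarrow> f u = 0"
  by (simp add: eig_def supported_def)

lemma eig_eq: "f \<in> eig S \<Longrightarrow> u \<in> S \<Longrightarrow> lam * f u = sum f (nb S u)"
  by (simp add: eig_def)

lemma subspace_eig: "fvs.subspace (eig S)"
proof (rule fvs_subspaceI)
  fix f g c assume "f \<in> eig S" "g \<in> eig S"
  then show "(\<lambda>x. c * f x + g x) \<in> eig S"
    by (simp add: eig_def supported_def sum.distrib sum_distrib_left[symmetric] distrib_left
        mult.left_commute[of lam c])
qed (simp add: eig_def supported_def)

lemma eig_restrict:
  assumes "finite S" "f \<in> eig S" "T \<subseteq> S" "\<And>u. u \<in> S - T \<Longrightarrow> f u = 0"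
  shows "f \<in> eig T"
proof -
  have "sum f (nb T u) = sum f (nb S u)" for u
    using assms by (intro sum.mono_neutral_left) (auto simp: nb_def)
  then show ?thesis using assms by (auto simp: eig_def supported_def)
qed

text \<open>No edge leaves a component, so each neighbour sum is either kept whole or erased
  entirely.\<close>

lemma eig_component:
  assumes S: "finite S" and f: "f \<in> eig S" and y: "y \<in> S"
  shows "(\<lambda>v. if v \<in> reach S y then f v else 0) \<in> eig S"
proof -
  let ?C = "reach S y"
  have "lam * (if u \<in> ?C then f u else 0) = sum f (nb S u \<inter> ?C)" if u: "u \<in> S" for u
  proof (cases "u \<in> ?C")
    case True
    then have "nb S u \<inter> ?C = nb S u" using reach_step[OF True u] by blast
    then show ?thesis using True eig_eq[OF f u] by simp
  next
    case False
    have "nb S u \<inter> ?C = {}"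
    proof (rule ccontr)
      assume "nb S u \<inter> ?C \<noteq> {}"
      then obtain w where "w \<in> nb S u" "w \<in> ?C" by blast
      then have "u \<in> ?C" using reach_step[of w S y u] u by (auto simp: nb_def adj_commute)
      then show False using False by contradiction
    qed
    then show ?thesis using False by simp
  qed
  then show ?thesis using S f by (auto simp: eig_def supported_def sum_if_Int)
qed

lemma mult_mono_eig: "finite S \<Longrightarrow> E \<subseteq> eig S \<Longrightarrow> fvs.dim E \<le> mult S"
  unfolding mult_def by (rule fvs_dim_mono[OF _ eig_supported subspace_eig])

lemma eig_eq_of_mult:
  "finite S \<Longrightarrow> fvs.subspace E \<Longrightarrow> E \<subseteq> eig S \<Longrightarrow> mult S \<le> fvs.dim E \<Longrightarrow> E = eig S"
  unfolding mult_def by (rule fvs_dim_eq[OF _ eig_supported _ subspace_eig])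

lemma mult_le_vanishing:
  "finite S \<Longrightarrow> mult S \<le> Suc (fvs.dim {f \<in> eig S. f u = 0})"
  unfolding mult_def by (rule fvs_dim_le_Suc_vanishing[OF _ eig_supported subspace_eig])

lemma mult_eq_vanishing:
  "finite S \<Longrightarrow> f \<in> eig S \<Longrightarrow> f u \<noteq> 0 \<Longrightarrow> mult S = Suc (fvs.dim {f \<in> eig S. f u = 0})"
  unfolding mult_def by (rule fvs_dim_vanishing[OF _ eig_supported subspace_eig])

lemma vanishing_subset_eig_remove:
  "finite S \<Longrightarrow> {f \<in> eig S. f x = 0} \<subseteq> eig (S - {x})"
  by (auto intro: eig_restrict)

lemma mult_remove: "finite S \<Longrightarrow> mult S \<le> Suc (mult (S - {x}))"
  using mult_le_vanishing[of S x] mult_mono_eig[OF _ vanishing_subset_eig_remove[of S x]]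
  by (meson Suc_le_mono finite_Diff order_trans)

end

section \<open>The inequality\<close>

context sgraph
begin

text \<open>The exceptional \<open>w\<close> may fail to be a neighbour of \<open>v\<close>; then
  all neighbours of \<open>v\<close> are leaves. The middle condition guarantees at least one leaf
  at \<open>v\<close>.\<close>

definition pre_leaf :: "'a set \<Rightarrow> 'a \<Rightarrow> 'a \<Rightarrow> bool" where
  "pre_leaf S v w \<longleftrightarrow> v \<in> S \<and> \<not> nb S v \<subseteq> {w} \<and> (\<forall>z\<in>nb S v. z \<noteq> w \<longrightarrow> nb S z = {v})"

text \<open>Among the edges \<open>wv\<close> with \<open>v\<close> not a leaf, one that minimises the component of \<open>v\<close> in
  \<open>S - {w}\<close> has only leaves behind it.\<close>

lemma pre_leaf_exists:
  assumes S: "finite S" and acyclic: "\<And>x. x \<in> S \<Longrightarrow> \<not> cyclic S x"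
    and ab: "a \<in> S" "b \<in> nb S a"
  shows "\<exists>v w. pre_leaf S v w"
proof (cases "\<exists>w v. w \<in> S \<and> v \<in> nb S w \<and> nb S v \<noteq> {w}")
  case False
  \<comment> \<open>Here every edge is a component of its own; the choice \<open>w = a\<close>
    expresses that there is no exceptional neighbour.\<close>
  then have "pre_leaf S a a" using ab by (auto simp: pre_leaf_def)
  then show ?thesis by blast
next
  case True
  define P where "P = (\<lambda>(w, v). w \<in> S \<and> v \<in> nb S w \<and> nb S v \<noteq> {w})"
  define m where "m = (\<lambda>(w, v). card (reach (S - {w}) v))"
  have "\<exists>p. P p" using True by (auto simp: P_def)
  then obtain p where "P p" "\<forall>q. P q \<longrightarrow> m p \<le> m q" using ex_has_least_nat[of P _ m] by blast
  then obtain w v where P: "P (w, v)" and min: "\<And>q. P q \<Longrightarrow> m (w, v) \<le> m q" by (cases p) auto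
  have w: "w \<in> S" and v: "v \<in> S" "v \<noteq> w" and wv: "w \<in> nb S v" and "nb S v \<noteq> {w}"
    using P nb_sym[of v S w] by (auto simp: P_def nb_def)
  have "nb S z = {v}" if z: "z \<in> nb S v" "z \<noteq> w" for z
  proof (rule ccontr)
    assume "nb S z \<noteq> {v}"
    then have "P (v, z)" using z v by (simp add: P_def)
    have zS: "z \<in> S - {v}" using z by (auto simp: nb_def)
    have wz: "w \<notin> reach (S - {v}) z" using acyclic[OF v(1)] z wv by (auto simp: cyclic_def)
    have zv: "z \<in> reach (S - {w}) v"
      using z v by (intro reach_step[OF reach_refl]) (auto simp: nb_def)
    \<comment> \<open>As no cycle passes through \<open>v\<close>, a walk from \<open>z\<close>
      avoiding \<open>v\<close> never meets \<open>w\<close>, so it stays in the component of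
      \<open>v\<close> in \<open>S - {w}\<close>. That component also contains \<open>v\<close>, so
      the one of \<open>z\<close> is strictly smaller, against minimality.\<close>
    have sub: "reach (S - {v}) z \<subseteq> reach (S - {v}) z \<inter> reach (S - {w}) v"
    proof (rule reach_closed)
      show "z \<in> reach (S - {v}) z \<inter> reach (S - {w}) v" using zv by simp
    next
      fix c d assume c: "c \<in> reach (S - {v}) z \<inter> reach (S - {w}) v" "c \<in> S - {v}"
        and d: "d \<in> nb (S - {v}) c"
      have dz: "d \<in> reach (S - {v}) z" using reach_step[of c "S - {v}" z d] c d by blast
      then have "d \<noteq> w" "c \<noteq> w" using wz c by auto
      then have "d \<in> reach (S - {w}) v"
        using reach_step[of c "S - {w}" v d] c d by (auto simp: nb_def)
      then show "d \<in> reach (S - {v}) z \<inter> reach (S - {w}) v" using dz by simp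
    qed
    have "v \<notin> reach (S - {v}) z" using reach_subset[OF zS] by blast
    then have "reach (S - {v}) z \<subset> reach (S - {w}) v" using sub by auto
    moreover have "finite (reach (S - {w}) v)"
      using reach_subset[of v "S - {w}"] v S by (simp add: finite_subset)
    ultimately have "m (v, z) < m (w, v)" by (simp add: m_def psubset_card_mono)
    then show False using min[OF \<open>P (v, z)\<close>] by simp
  qed
  moreover have "\<not> nb S v \<subseteq> {w}" using wv \<open>nb S v \<noteq> {w}\<close> by blast
  ultimately have "pre_leaf S v w" using v by (simp add: pre_leaf_def)
  then show ?thesis by blast
qed

text \<open>A leaf \<open>y\<close> at \<open>v\<close> provides the additional edge
  \<open>{v, y}\<close>, all of whose contacts lie in the deleted closed neighbourhood.\<close>

lemma imn_remove_closed_nb: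
  assumes "pre_leaf S v w"
  shows "Suc (imn (S - insert v (nb S v))) \<le> imn S"
proof -
  obtain y where y: "y \<in> nb S v" "y \<noteq> w" "nb S y = {v}" and "v \<in> S"
    using assms by (auto simp: pre_leaf_def)
  then show ?thesis by (intro imn_add_edge[of v y]) (auto simp: nb_def)
qed

lemma imn_remove_isolated:
  assumes "T \<subseteq> S" "\<And>y. y \<in> S - T \<Longrightarrow> nb S y = {}"
  shows "imn S \<le> imn T"
proof -
  obtain M where M: "imatch S M" "card M = imn S" by (rule imn_obtain)
  have "u \<in> T" if eu: "e \<in> M" "u \<in> e" for e u
  proof (rule ccontr)
    assume "u \<notin> T"
    have e: "e \<in> edges G" "e \<subseteq> S" using M(1) eu imatch_edges by (auto simp: imatch_def)
    obtain w where "e = {u, w}" using card_edge[OF e(1)] eu(2) by (auto simp: card_2_iff)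
    then have "w \<in> nb S u" using e by (simp add: nb_def)
    then show False using assms(2)[of u] \<open>u \<notin> T\<close> e(2) eu(2) by auto
  qed
  then have "imatch T M" using M(1) by (auto simp: imatch_def)
  then show ?thesis using card_le_imn M(2) by metis
qed

text \<open>On a walk from \<open>y\<close> to \<open>z\<close> off \<open>x\<close>, let
  \<open>c\<close> follow the last visit to \<open>y\<close>. Then \<open>c\<close> reaches
  \<open>z\<close> off both \<open>x\<close> and \<open>y\<close>, and from there \<open>x\<close>;
  so \<open>c\<close> and \<open>x\<close> are neighbours of \<open>y\<close> joined off
  \<open>y\<close>. The set \<open>C\<close> collects the end points of such walks.\<close>

lemma cyclic_neighbour:
  assumes x: "x \<in> S" and y: "y \<in> nb S x" "z \<in> nb S x" "y \<noteq> z" "z \<in> reach (S - {x}) y"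
  shows "cyclic S y"
proof -
  define C where "C = insert y (\<Union>c\<in>nb (S - {x}) y. reach (S - {x, y}) c)"
  have "reach (S - {x}) y \<subseteq> C"
  proof (rule reach_closed)
    fix a b assume a: "a \<in> C" "a \<in> S - {x}" and b: "b \<in> nb (S - {x}) a"
    show "b \<in> C"
    proof (cases "a = y \<or> b = y")
      case True
      then show ?thesis using b reach_refl[of b "S - {x, y}"] unfolding C_def by blast
    next
      case False
      then obtain c where c: "c \<in> nb (S - {x}) y" "a \<in> reach (S - {x, y}) c"
        using a by (auto simp: C_def)
      have "b \<in> reach (S - {x, y}) c"
        using reach_step[OF c(2), of b] False a b by (auto simp: nb_def)
      then show ?thesis using c by (auto simp: C_def)
    qed
  qed (simp add: C_def)
  then obtain c where c: "c \<in> nb (S - {x}) y" "z \<in> reach (S - {x, y}) c"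
    using y by (auto simp: C_def)
  have "z \<in> reach (S - {y}) c" using c(2) reach_mono[of "S - {x, y}" "S - {y}" c] by blast
  then have "x \<in> reach (S - {y}) c"
    using reach_step[of z "S - {y}" c x] x y adj_neq[of x y] adj_commute[of x] by (auto simp: nb_def)
  moreover have "c \<in> nb S y" "x \<in> nb S y" "c \<noteq> x"
    using c(1) y(1) x by (auto simp: nb_def adj_commute)
  ultimately show ?thesis unfolding cyclic_def by blast
qed

definition core :: "'a set \<Rightarrow> 'a \<Rightarrow> 'a set" where
  "core S x = {y \<in> nb S x. cyclic S y}"

lemma core_sym: "y \<in> core S x \<Longrightarrow> x \<in> S \<Longrightarrow> cyclic S x \<Longrightarrow> x \<in> core S y"
  by (simp add: core_def nb_sym)

end

context graph_ev
begin

text \<open>The equation at a leaf reads \<open>lam * f z = f v\<close>, so \<open>f\<close> is zero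
  on the leaves; in the equation at \<open>v\<close> the value \<open>f w\<close> is then the only
  term left.\<close>

lemma pre_leaf_vanishing:
  assumes S: "finite S" and vw: "pre_leaf S v w" and f: "f \<in> eig S" "f v = 0"
  shows "f \<in> eig (S - insert v (nb S v))"
proof -
  have v: "v \<in> S" using vw by (simp add: pre_leaf_def)
  have leaf: "f z = 0" if "z \<in> nb S v" "z \<noteq> w" for z
  proof -
    have "nb S z = {v}" "z \<in> S" using vw that by (auto simp: pre_leaf_def nb_def)
    then show ?thesis using eig_eq[OF f(1), of z] f(2) lam by simp
  qed
  have "f w = 0" if w: "w \<in> nb S v"
  proof -
    have "sum f (nb S v) = f w + sum f (nb S v - {w})" using S w by (simp add: sum.remove)
    also have "sum f (nb S v - {w}) = 0" using leaf by (intro sum.neutral) auto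
    finally show ?thesis using eig_eq[OF f(1) v] f(2) by simp
  qed
  then have "f u = 0" if "u \<in> nb S v" for u using leaf that by blast
  then show ?thesis using f by (intro eig_restrict[OF S f(1)]) auto
qed

lemma mult_remove_closed_nb:
  assumes "finite S" "pre_leaf S v w"
  shows "fvs.dim {f \<in> eig S. f v = 0} \<le> mult (S - insert v (nb S v))"
  using pre_leaf_vanishing[OF assms] assms(1) by (intro mult_mono_eig) auto

lemma mult_edgeless:
  assumes "\<And>u. u \<in> S \<Longrightarrow> nb S u = {}"
  shows "mult S = 0"
proof -
  have "f = (\<lambda>_. 0)" if f: "f \<in> eig S" for f
  proof
    fix u show "f u = 0"
      using eig_eq[OF f, of u] eig_outside[OF f, of u] assms[of u] lam by (cases "u \<in> S") auto
  qed
  then have "eig S = {\<lambda>_. 0}" using fvs_subspace_zero[OF subspace_eig] by blast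
  then show ?thesis by (simp add: mult_def fvs_dim_zero)
qed

lemma mult_le:
  assumes "finite S"
  shows "int (mult S) \<le> int (imn S) + cyc S"
  using assms
proof (induction S rule: finite_psubset_induct)
  case (psubset S)
  show ?case
  proof (cases "\<exists>x\<in>S. cyclic S x")
    case True
    then obtain x where x: "x \<in> S" "cyclic S x" by blast
    then have "int (mult (S - {x})) \<le> int (imn (S - {x})) + cyc (S - {x})"
      by (intro psubset.IH) auto
    then show ?thesis
      using mult_remove[OF psubset.hyps, of x] cyc_remove_cyclic[OF psubset.hyps x]
        imn_mono[of "S - {x}" S] by simp
  next
    case acyclic: False
    show ?thesis
    proof (cases "\<exists>a\<in>S. nb S a \<noteq> {}")
      case True
      then obtain v w where vw: "pre_leaf S v w"
        using pre_leaf_exists[OF psubset.hyps] acyclic by blast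
      let ?T = "S - insert v (nb S v)"
      have "int (mult ?T) \<le> int (imn ?T) + cyc ?T"
        using vw by (intro psubset.IH) (auto simp: pre_leaf_def)
      moreover have "cyc ?T = 0"
        using acyclic cyclic_mono[of ?T S] psubset.hyps by (intro cyc_acyclic) auto
      ultimately show ?thesis
        using mult_le_vanishing[OF psubset.hyps, of v] mult_remove_closed_nb[OF psubset.hyps vw]
          imn_remove_closed_nb[OF vw] cyc_nonneg[OF psubset.hyps] by simp
    next
      case False
      then show ?thesis using mult_edgeless[of S] cyc_nonneg[OF psubset.hyps] by simp
    qed
  qed
qed

definition extremal :: "'a set \<Rightarrow> bool" where
  "extremal S \<longleftrightarrow> int (mult S) = int (imn S) + cyc S"

text \<open>Cut \<open>g\<close> down to the component of \<open>y\<close> in \<open>T\<close>: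
  among the neighbours of \<open>x\<close> only \<open>y\<close> lies there, so the sum is
  \<open>g y\<close>. Such an \<open>h\<close> is the contradiction wherever eigenfunctions of
  \<open>T\<close> must sum to zero around \<open>x\<close>.\<close>

lemma component_sum:
  assumes S: "finite S" "T \<subseteq> S" and g: "g \<in> eig T" "y \<in> T" "g y \<noteq> 0" and y: "y \<in> nb S x"
    and only: "\<And>z. z \<in> nb S x \<Longrightarrow> z \<noteq> y \<Longrightarrow> z \<notin> reach T y"
  obtains h where "h \<in> eig T" "sum h (nb S x) \<noteq> 0"
proof
  let ?h = "\<lambda>v. if v \<in> reach T y then g v else 0"
  show "?h \<in> eig T" using S g by (intro eig_component) (auto intro: finite_subset)
  have "sum ?h (nb S x) = ?h y + sum ?h (nb S x - {y})" using S y by (simp add: sum.remove)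
  also have "sum ?h (nb S x - {y}) = 0" using only by (intro sum.neutral) auto
  finally show "sum ?h (nb S x) \<noteq> 0" using g by simp
qed

text \<open>If all eigenfunctions vanished at \<open>u\<close>, the bound for \<open>S - {u}\<close>
  would be tight with the same multiplicity, \<open>imn\<close> and \<open>cyc\<close>. So
  \<open>u\<close> lies on no cycle, and by induction a neighbour that is not isolated in
  \<open>S - {u}\<close> would violate the equation at \<open>u\<close> through
  \<open>component_sum\<close>. Hence all neighbours become isolated; but deleting such a star costs
  an edge of the induced matching.\<close>

lemma extremal_nonvanishing:
  assumes "finite S" "extremal S" "u \<in> S" "nb S u \<noteq> {}"
  shows "\<exists>f\<in>eig S. f u \<noteq> 0"
  using assms
proof (induction S arbitrary: u rule: finite_psubset_induct)
  case (psubset S)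
  note S = psubset.hyps and u = \<open>u \<in> S\<close>
  let ?T = "S - {u}"
  show ?case
  proof (rule ccontr)
    assume "\<not> ?case"
    then have zero: "f u = 0" if "f \<in> eig S" for f using that by blast
    have sub: "eig S \<subseteq> eig ?T" using zero vanishing_subset_eig_remove[OF S, of u] by blast
    have T: "finite ?T" using S by simp
    have le: "mult S \<le> mult ?T" using mult_mono_eig[OF T sub] by (simp add: mult_def)
    have "int (mult ?T) \<le> int (imn ?T) + cyc ?T" by (rule mult_le[OF T])
    moreover have "int (mult S) = int (imn S) + cyc S" using psubset.prems(1) by (simp add: extremal_def)
    moreover have "imn ?T \<le> imn S" by (rule imn_mono) auto
    moreover have "cyc ?T \<le> cyc S" by (rule cyc_remove_le[OF S u])
    ultimately have ext: "extremal ?T" and imn: "imn ?T = imn S" and cyc: "cyc ?T = cyc S"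
      and mult: "mult ?T = mult S" using le by (auto simp: extremal_def)
    have eig: "eig S = eig ?T"
      using mult by (intro eig_eq_of_mult[OF T subspace_eig sub]) (simp add: mult_def)
    have "\<not> cyclic S u" using cyc_remove_cyclic[OF S u] cyc by auto
    then have only: "z \<notin> reach ?T y" if "y \<in> nb S u" "z \<in> nb S u" "z \<noteq> y" for y z
      using that by (auto simp: cyclic_def)
    have iso: "nb ?T y = {}" if y: "y \<in> nb S u" for y
    proof (rule ccontr)
      assume "nb ?T y \<noteq> {}"
      moreover have yT: "y \<in> ?T" using y by (auto simp: nb_def)
      ultimately obtain g where g: "g \<in> eig ?T" "g y \<noteq> 0"
        using psubset.IH[of ?T y] u ext by blast
      obtain h where h: "h \<in> eig ?T" "sum h (nb S u) \<noteq> 0"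
        using component_sum[OF S _ g(1) yT g(2) y] only[OF y] by blast
      then have "h \<in> eig S" using eig by simp
      from eig_eq[OF this u] zero[OF this] h(2) show False by simp
    qed
    obtain y where y: "y \<in> nb S u" using psubset.prems(3) by blast
    have nby: "nb S y = {u}" using iso[OF y] nb_sym[OF y u] by (auto simp: nb_Diff)
    let ?R = "S - insert u (nb S u)"
    have "imn ?T \<le> imn ?R" by (rule imn_remove_isolated) (use iso in auto)
    moreover have "Suc (imn ?R) \<le> imn S"
      using y nby u by (intro imn_add_edge[of u y]) (auto simp: nb_def)
    ultimately show False using imn by simp
  qed
qed

text \<open>Every inequality used in deleting \<open>x\<close> becomes tight. In particular each
  eigenfunction of the rest, extended by zero, is one of \<open>S\<close>, and its equation at
  \<open>x\<close> is the last claim.\<close>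

lemma extremal_remove_cyclic:
  assumes S: "finite S" and ext: "extremal S" and x: "x \<in> S" "cyclic S x"
  shows "extremal (S - {x})" "cyc S = cyc (S - {x}) + 1"
    "\<And>g. g \<in> eig (S - {x}) \<Longrightarrow> sum g (nb S x) = 0"
proof -
  let ?T = "S - {x}" and ?E = "{f \<in> eig S. f x = 0}"
  have T: "finite ?T" using S by simp
  have le: "fvs.dim ?E \<le> mult ?T"
    by (rule mult_mono_eig[OF T vanishing_subset_eig_remove[OF S]])
  have "int (mult ?T) \<le> int (imn ?T) + cyc ?T" by (rule mult_le[OF T])
  moreover have "int (mult S) = int (imn S) + cyc S" using ext by (simp add: extremal_def)
  moreover have "imn ?T \<le> imn S" by (rule imn_mono) auto
  moreover have "cyc ?T + 1 \<le> cyc S" by (rule cyc_remove_cyclic[OF S x])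
  moreover have "mult S \<le> Suc (fvs.dim ?E)" by (rule mult_le_vanishing[OF S])
  ultimately have "extremal ?T" "cyc S = cyc ?T + 1" and ge: "mult ?T \<le> fvs.dim ?E"
    using le by (auto simp: extremal_def)
  then show "extremal ?T" "cyc S = cyc ?T + 1" by simp_all
  have "?E = eig ?T"
    using ge vanishing_subset_eig_remove[OF S]
    by (intro eig_eq_of_mult[OF T fvs_subspace_vanishing[OF subspace_eig]])
  then have E: "g \<in> eig S" "g x = 0" if "g \<in> eig ?T" for g using that by blast+
  show "sum g (nb S x) = 0" if "g \<in> eig ?T" for g
    using eig_eq[OF E(1)[OF that] x(1)] E(2)[OF that] by simp
qed

end

section \<open>Structure of extremal graphs\<close>

locale extremal_set = graph_ev G lam for G :: "'a ugraph" and lam +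
  fixes S :: "'a set"
  assumes fin: "finite S" and ext: "extremal S"
begin

text \<open>As \<open>cyc\<close> drops by exactly one, there is one neighbour more than there are
  components meeting the neighbourhood: only one pair of neighbours shares a component. A third
  neighbour that is not a leaf would, by nonvanishing and \<open>component_sum\<close>, share its
  component with another neighbour, a second coincidence.\<close>

lemma core_structure:
  assumes x: "x \<in> S" "cyclic S x"
  shows card_core: "card (core S x) = 2"
    and non_core: "\<And>z. z \<in> nb S x \<Longrightarrow> z \<notin> core S x \<Longrightarrow> nb S z = {x}"
proof -
  let ?T = "S - {x}" and ?N = "nb S x"
  let ?R = "reach ?T"
  have finN: "finite ?N" using fin by simp
  have card: "card ?N = Suc (card (?R ` ?N))"
    using cyc_remove[OF fin x(1)] extremal_remove_cyclic(2)[OF fin ext x] by simp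
  obtain y1 y2 where y: "y1 \<in> ?N" "y2 \<in> ?N" "y1 \<noteq> y2" "y2 \<in> ?R y1"
    using x(2) by (auto simp: cyclic_def)
  have R12: "?R y2 = ?R y1" using y(4) by (rule reach_eq)
  have iso: "nb ?T z = {}" if z: "z \<in> ?N" "z \<noteq> y1" "z \<noteq> y2" for z
  proof (rule ccontr)
    assume "nb ?T z \<noteq> {}"
    moreover have zT: "z \<in> ?T" using z by (auto simp: nb_def)
    ultimately obtain g where g: "g \<in> eig ?T" "g z \<noteq> 0"
      using extremal_nonvanishing[OF _ extremal_remove_cyclic(1)[OF fin ext x]] fin by blast
    have "\<exists>z'\<in>?N. z' \<noteq> z \<and> z' \<in> ?R z"
    proof (rule ccontr)
      assume "\<not> ?thesis"
      then obtain h where "h \<in> eig ?T" "sum h ?N \<noteq> 0"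
        using component_sum[OF fin _ g(1) zT g(2) z(1)] by blast
      then show False using extremal_remove_cyclic(3)[OF fin ext x] by blast
    qed
    then obtain z' where z': "z' \<in> ?N" "z' \<noteq> z" "?R z' = ?R z" using reach_eq by blast
    \<comment> \<open>\<open>y\<close> is the one of \<open>y1\<close>, \<open>y2\<close> that
      differs from \<open>z'\<close>, and \<open>y'\<close> is the other. Both \<open>y\<close> and
      \<open>z\<close> can then be dropped without losing a component.\<close>
    obtain y y' where yy: "y \<in> ?N" "y' \<in> ?N" "y \<noteq> y'" "?R y = ?R y'" "y \<noteq> z" "y \<noteq> z'" "y' \<noteq> z"
      using y z R12 by metis
    have "?R ` ?N \<subseteq> ?R ` (?N - {y, z})"
    proof (rule image_subsetI)
      fix u assume u: "u \<in> ?N"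
      consider "u = y" | "u = z" | "u \<noteq> y" "u \<noteq> z" by blast
      then show "?R u \<in> ?R ` (?N - {y, z})"
      proof cases
        case 1
        then show ?thesis using yy by (intro image_eqI[of _ _ y']) auto
      next
        case 2
        then show ?thesis using z' yy by (intro image_eqI[of _ _ z']) auto
      qed (use u in auto)
    qed
    then have "card (?R ` ?N) \<le> card (?N - {y, z})"
      using finN by (meson card_image_le card_mono finite_Diff finite_imageI le_trans)
    also have "\<dots> = card ?N - 2" using yy z(1) finN by (simp add: card_Diff_subset)
    finally have "card (?R ` ?N) \<le> card ?N - 2" .
    \<comment> \<open>The subtraction above is truncated, so positivity is needed to contradict
      \<open>card\<close>.\<close>
    moreover have "0 < card (?R ` ?N)" using y(1) finN by (auto simp: card_gt_0_iff)
    ultimately show False using card by simp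
  qed
  have leaf: "nb S z = {x}" if "z \<in> ?N" "z \<noteq> y1" "z \<noteq> y2" for z
    using iso[OF that] nb_sym[OF that(1) x(1)] by (auto simp: nb_Diff)
  have "cyclic S y1" by (rule cyclic_neighbour[OF x(1) y])
  moreover have "cyclic S y2"
    using y reach_sym[OF y(4)] by (intro cyclic_neighbour[OF x(1), of y2 y1]) auto
  moreover have "\<not> cyclic S z" if "nb S z = {x}" for z using that by (auto simp: cyclic_def)
  ultimately have "core S x = {y1, y2}" using y leaf by (auto simp: core_def)
  then show "card (core S x) = 2" "\<And>z. z \<in> nb S x \<Longrightarrow> z \<notin> core S x \<Longrightarrow> nb S z = {x}"
    using y(3) leaf by auto
qed

lemma core_other:
  assumes "x \<in> S" "cyclic S x" "a \<in> core S x"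
  obtains b where "b \<noteq> a" "core S x = {a, b}"
proof -
  have "card (core S x) = 2" by (rule card_core[OF assms(1,2)])
  then obtain c d where "core S x = {c, d}" "c \<noteq> d" by (auto simp: card_2_iff)
  then show thesis using assms(3) that[of c] that[of d] by (auto simp: insert_commute)
qed

lemma core_in: "y \<in> core S x \<Longrightarrow> y \<in> S \<and> cyclic S y \<and> y \<in> nb S x \<and> y \<noteq> x"
  by (auto simp: core_def nb_def)

lemma nb_cyclic: "cyclic S y \<Longrightarrow> y \<in> nb S x \<longleftrightarrow> y \<in> core S x"
  by (simp add: core_def)

text \<open>Meant for \<open>z\<close> on a cycle, where \<open>non_core\<close> shows that these
  are the pendant neighbours.\<close>

definition leaves :: "'a \<Rightarrow> 'a set" where
  "leaves z = nb S z - core S z"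

lemma leaf_nb: "z \<in> S \<Longrightarrow> cyclic S z \<Longrightarrow> l \<in> leaves z \<Longrightarrow> nb S l = {z} \<and> l \<in> S \<and> \<not> cyclic S l"
  using non_core[of z l] by (auto simp: leaves_def core_def nb_def)

text \<open>The equation at \<open>z\<close> multiplied by \<open>lam\<close>, with the leaf values
  eliminated through \<open>lam * g l = g z\<close>.\<close>

lemma leaf_equation:
  assumes z: "z \<in> S" "cyclic S z" and x: "cyclic S x" "x \<noteq> z" and g: "g \<in> eig (S - {x})"
  shows "lam * lam * g z = lam * sum g (core S z - {x}) + of_nat (card (leaves z)) * g z"
proof -
  have nb: "nb (S - {x}) z = (core S z - {x}) \<union> leaves z"
    using x by (auto simp: nb_Diff leaves_def core_def)
  have finite: "finite (core S z - {x})" "finite (leaves z)"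
    using fin by (auto simp: core_def leaves_def)
  have l: "lam * g l = g z" if "l \<in> leaves z" for l
  proof -
    have l: "nb S l = {z}" "l \<in> S" "\<not> cyclic S l" using leaf_nb[OF z that] by auto
    then have "l \<in> S - {x}" "nb (S - {x}) l = {z}" using x by (auto simp: nb_Diff)
    then show ?thesis using eig_eq[OF g, of l] by simp
  qed
  have "lam * g z = sum g (core S z - {x}) + sum g (leaves z)"
    using eig_eq[OF g, of z] z x nb finite
    by (simp add: sum.union_disjoint leaves_def Diff_Int_distrib2 Int_Diff)
  moreover have "lam * sum g (leaves z) = of_nat (card (leaves z)) * g z"
    using l by (simp add: sum_distrib_left)
  ultimately show ?thesis by (simp add: mult.assoc distrib_left)
qed

text \<open>Once \<open>x\<close> is deleted its leaves are isolated, so \<open>g\<close> vanishes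
  there and the zero sum around \<open>x\<close> reduces to the core neighbours.\<close>

lemma core_balance:
  assumes x: "x \<in> S" "cyclic S x" and g: "g \<in> eig (S - {x})"
  shows "sum g (core S x) = 0"
proof -
  have "g l = 0" if "l \<in> leaves x" for l
  proof -
    have l: "nb S l = {x}" "l \<in> S" "\<not> cyclic S l" using leaf_nb[OF x that] by auto
    then have "l \<in> S - {x}" "nb (S - {x}) l = {}" using x by (auto simp: nb_Diff)
    then show ?thesis using eig_eq[OF g, of l] lam by simp
  qed
  then have "sum g (core S x) = sum g (nb S x)"
    using fin by (intro sum.mono_neutral_left) (auto simp: core_def leaves_def)
  then show ?thesis using extremal_remove_cyclic(3)[OF fin ext x g] by simp
qed

lemma nonvanishing_off:
  assumes x: "x \<in> S" "cyclic S x" and z: "z \<in> S" "z \<noteq> x" "y \<in> nb S z" "y \<noteq> x"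
  obtains g where "g \<in> eig (S - {x})" "g z \<noteq> 0"
  using extremal_nonvanishing[OF _ extremal_remove_cyclic(1)[OF fin ext x], of z] fin z
  by (auto simp: nb_Diff)

text \<open>Balance at \<open>x\<close> gives \<open>g y = - g z\<close>. The leaf equation at
  \<open>z\<close> then involves \<open>g z\<close> alone, and some \<open>g\<close> is nonzero
  there.\<close>

lemma triangle_leaves:
  assumes x: "x \<in> S" "cyclic S x" and core: "core S x = {y, z}" "core S z = {x, y}"
    and d: "y \<noteq> z" "x \<noteq> y" "x \<noteq> z"
  shows "of_nat (card (leaves z)) = lam * lam + lam"
proof -
  have z: "z \<in> S" "cyclic S z" and y: "y \<in> nb S z"
    using core core_in[of z x] core_in[of y z] by auto
  obtain g where g: "g \<in> eig (S - {x})" "g z \<noteq> 0"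
    using nonvanishing_off[OF x z(1) _ y] d by auto
  have "g y = - g z" using core_balance[OF x g(1)] core(1) d by (simp add: eq_neg_iff_add_eq_0)
  moreover have "core S z - {x} = {y}" using core d by auto
  ultimately have "lam * lam * g z = lam * (- g z) + of_nat (card (leaves z)) * g z"
    using leaf_equation[OF z x(2) d(3) g(1)] by simp
  then have "g z * (of_nat (card (leaves z)) - (lam * lam + lam)) = 0" by (simp add: algebra_simps)
  then show ?thesis using g(2) by simp
qed

text \<open>\<open>x\<close> and \<open>z\<close> are opposite corners of a 4-cycle. Balance at
  \<open>x\<close> makes the core sum at \<open>z\<close> zero, so without leaves the equation would
  read \<open>lam * lam * g z = 0\<close>.\<close>

lemma square_leaves:
  assumes x: "x \<in> S" "cyclic S x" and core: "core S x = {y1, y2}" "core S z = {y1, y2}"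
    and d: "y1 \<noteq> y2" "x \<noteq> z" and z: "z \<in> S" "cyclic S z"
  shows "leaves z \<noteq> {}"
proof
  assume no: "leaves z = {}"
  have y: "y1 \<in> nb S z" "y1 \<noteq> x" using core core_in[of y1 x] core_in[of y1 z] by auto
  obtain g where g: "g \<in> eig (S - {x})" "g z \<noteq> 0"
    using nonvanishing_off[OF x z(1) _ y] d by auto
  have "x \<notin> {y1, y2}" using core_in[of x x] core(1) by auto
  then have "core S z - {x} = core S x" using core by auto
  then have "lam * lam * g z = 0"
    using leaf_equation[OF z x(2) d(2) g(1)] core_balance[OF x g(1)] no by simp
  then show False using g(2) lam by simp
qed

text \<open>An eigenfunction is determined by its values at two adjacent cycle vertices: each
  further cycle vertex is fixed by the equation at the one before it, each leaf by its own
  equation.\<close>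

lemma mult_le_2:
  assumes conn: "reach S x = S" and x: "x \<in> S" "cyclic S x"
  shows "mult S \<le> 2"
proof -
  obtain y where y: "y \<in> core S x" using card_core[OF x] by (metis card.empty ex_in_conv zero_neq_numeral)
  have zero: "f = (\<lambda>_. 0)" if f: "f \<in> eig S" "f x = 0" "f y = 0" for f
  proof -
    \<comment> \<open>The state carried along the cycle is a pair of adjacent zeros. A single zero
      would only relate the two core neighbours to each other.\<close>
    define B where "B = {z \<in> S. cyclic S z \<and> f z = 0 \<and> (\<exists>a\<in>core S z. f a = 0)}"
    have leaf: "f l = 0" if "z \<in> B" "l \<in> leaves z" for z l
    proof -
      have "nb S l = {z}" "l \<in> S" "f z = 0" using leaf_nb[of z l] that by (auto simp: B_def)
      then show ?thesis using eig_eq[OF f(1), of l] lam by simp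
    qed
    have core: "f b = 0" if z: "z \<in> B" and b: "b \<in> core S z" for z b
    proof -
      have zS: "z \<in> S" "cyclic S z" and "f z = 0" using z by (auto simp: B_def)
      obtain a where a: "a \<in> core S z" "f a = 0" using z by (auto simp: B_def)
      obtain a' where a': "a' \<noteq> a" "core S z = {a, a'}" using core_other[OF zS a(1)] by blast
      have "sum f (nb S z) = sum f (core S z)"
        using fin leaf[OF z] by (intro sum.mono_neutral_right) (auto simp: core_def leaves_def)
      then have "f a' = 0" using eig_eq[OF f(1) zS(1)] \<open>f z = 0\<close> a a' by simp
      then show ?thesis using a a' b by auto
    qed
    define C where "C = B \<union> {l. f l = 0 \<and> (\<exists>z\<in>B. nb S l = {z})}"
    have "reach S x \<subseteq> C"
    proof (rule reach_closed)
      show "x \<in> C" using x f y by (auto simp: C_def B_def)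
      fix a b assume a: "a \<in> C" "a \<in> S" and b: "b \<in> nb S a"
      show "b \<in> C"
      proof (cases "a \<in> B")
        case aB: True
        then have aS: "cyclic S a" by (simp add: B_def)
        show ?thesis
        proof (cases "b \<in> core S a")
          case True
          then have "a \<in> core S b" "b \<in> S" "cyclic S b" using a aS core_sym core_in by blast+
          then show ?thesis using core[OF aB True] aB by (auto simp: C_def B_def)
        next
          case False
          then have "b \<in> leaves a" using b by (simp add: leaves_def)
          then show ?thesis using leaf[OF aB] leaf_nb[OF a(2) aS] aB by (auto simp: C_def)
        qed
      next
        case False
        then show ?thesis using a b by (auto simp: C_def)
      qed
    qed
    then have "f u = 0" if "u \<in> S" for u using that conn by (auto simp: C_def B_def)
    then show ?thesis using eig_outside[OF f(1)] by blast
  qed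
  let ?E = "{f \<in> eig S. f x = 0}"
  have "mult S \<le> Suc (fvs.dim ?E)" by (rule mult_le_vanishing[OF fin])
  also have "fvs.dim ?E \<le> Suc (fvs.dim {f \<in> ?E. f y = 0})"
    using eig_supported by (intro fvs_dim_le_Suc_vanishing[OF fin _ fvs_subspace_vanishing[OF subspace_eig]]) auto
  also have "{f \<in> ?E. f y = 0} = {\<lambda>_. 0}"
    using zero fvs_subspace_zero[OF subspace_eig] by auto
  finally show ?thesis by (simp add: fvs_dim_zero)
qed

text \<open>A cycle contributes at least one to \<open>cyc S\<close>, and the multiplicity is at
  most two, so equality leaves at most one for \<open>imn S\<close>.\<close>

lemma imn_le_1:
  assumes "reach S x = S" and x: "x \<in> S" "cyclic S x"
  shows "imn S \<le> 1"
proof -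
  have "0 \<le> cyc (S - {x})" using fin by (intro cyc_nonneg) simp
  then have "1 \<le> cyc S" using extremal_remove_cyclic(2)[OF fin ext x] by simp
  then show ?thesis using mult_le_2[OF assms] ext by (simp add: extremal_def)
qed

lemma no_far_edges:
  assumes "imn S \<le> 1" and e: "b \<in> nb S a" "a \<in> S" "d \<in> nb S c" "c \<in> S"
    and off: "c \<notin> nb S a" "c \<notin> nb S b" "d \<notin> nb S a" "d \<notin> nb S b" "c \<noteq> a" "c \<noteq> b" "d \<noteq> a" "d \<noteq> b"
  shows False
proof -
  have "Suc (imn {c, d}) \<le> imn S"
    using e off by (intro imn_add_edge[of a b]) (auto simp: nb_def)
  moreover have "1 \<le> imn {c, d}" using e by (intro imn_pos[of c d]) (auto simp: nb_def)
  ultimately show False using assms(1) by simp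
qed

text \<open>A pendant edge at \<open>p0\<close> and the opposite edge \<open>{p2, p3}\<close> would
  form an induced matching.\<close>

lemma pentagon_no_leaf:
  assumes "imn S \<le> 1" and p: "p0 \<in> S" "cyclic S p0"
    and core: "core S p0 = {p1, p4}" "p3 \<in> core S p2" "p2 \<in> S" "cyclic S p2"
    and d: "distinct [p0, p1, p2, p3, p4]"
  shows "leaves p0 = {}"
proof (rule ccontr)
  assume "leaves p0 \<noteq> {}"
  then obtain l where l: "l \<in> leaves p0" by blast
  note ln = leaf_nb[OF p l]
  have "l \<in> nb S p0" using l by (simp add: leaves_def)
  moreover have p3: "p3 \<in> nb S p2" "cyclic S p3" using core core_in by blast+
  moreover have "p2 \<notin> nb S p0" "p3 \<notin> nb S p0" using core d p3 by (auto simp: nb_cyclic)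
  moreover have "p2 \<noteq> l" "p3 \<noteq> l" "p2 \<notin> nb S l" "p3 \<notin> nb S l" using ln core p3 d by auto
  ultimately show False using no_far_edges[OF assms(1), of l p0 p3 p2] p core d by auto
qed

text \<open>The walk \<open>z1, y1, x, y2, z2\<close> along core vertices must close up within five steps, since the
  edge leaving \<open>z1\<close> and the edge \<open>x y2\<close> would otherwise form an induced matching.\<close>

lemma core_cycle:
  assumes conn: "reach S x = S" and x: "x \<in> S" "cyclic S x"
  obtains
    (triangle) y z where "distinct [x, y, z]" "core S x = {y, z}" "core S y = {x, z}" "core S z = {x, y}"
  | (pentagon) y1 z1 z2 y2 where "distinct [x, y1, z1, z2, y2]" "core S x = {y1, y2}"
      "core S y1 = {x, z1}" "core S z1 = {y1, z2}" "core S z2 = {z1, y2}" "core S y2 = {x, z2}"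
proof -
  have imn: "imn S \<le> 1" by (rule imn_le_1[OF assms])
  obtain y1 y2 where y: "core S x = {y1, y2}" "y1 \<noteq> y2"
    using card_core[OF x] by (auto simp: card_2_iff)
  have y1: "y1 \<in> S" "cyclic S y1" "y1 \<noteq> x" and y2: "y2 \<in> S" "cyclic S y2" "y2 \<noteq> x"
    using core_in[of y1 x] core_in[of y2 x] y by auto
  have xy: "x \<in> core S y1" "x \<in> core S y2" using core_sym[OF _ x] y by auto
  obtain z1 where z1: "z1 \<noteq> x" "core S y1 = {x, z1}" using core_other[OF y1(1,2) xy(1)] by blast
  obtain z2 where z2: "z2 \<noteq> x" "core S y2 = {x, z2}" using core_other[OF y2(1,2) xy(2)] by blast
  have z1S: "z1 \<in> S" "cyclic S z1" "z1 \<noteq> y1" and z2S: "z2 \<in> S" "cyclic S z2" "z2 \<noteq> y2"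
    using core_in[of z1 y1] core_in[of z2 y2] z1 z2 by auto
  have yz: "y1 \<in> core S z1" "y2 \<in> core S z2" using core_sym y1 y2 z1 z2 by auto
  show thesis
  proof (cases "z1 = y2")
    case True
    then have "z2 = y1" using yz(1) z2 y1 by auto
    then show thesis using True y z1 z2 y1 y2 by (intro triangle[of y1 y2]) (auto simp: insert_commute)
  next
    case nadj: False
    then have z2y1: "z2 \<noteq> y1" using yz(2) z1 y2 by auto
    show thesis
    proof (cases "z1 = z2")
      case True
      \<comment> \<open>The cycle has length four. The opposite corners \<open>x\<close> and
        \<open>z1\<close> both carry leaves by \<open>square_leaves\<close>, and their pendant edges
        form an induced matching.\<close>
      have z: "core S z1 = {y1, y2}"
        using core_other[OF z1S(1,2) yz(1)] yz(2) True y(2) by (metis insert_iff singletonD)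
      obtain l where l: "l \<in> leaves z1"
        using square_leaves[OF x y(1) z y(2) _ z1S(1,2)] z1 by blast
      obtain l' where l': "l' \<in> leaves x"
        using square_leaves[OF z1S(1,2) z y(1) y(2) z1(1) x] by blast
      note ln = leaf_nb[OF z1S(1,2) l] and ln' = leaf_nb[OF x l']
      have "z1 \<notin> nb S x" using y z1S nadj by (auto simp: nb_cyclic)
      moreover have "l \<in> nb S z1" "l' \<in> nb S x" using l l' by (auto simp: leaves_def)
      moreover have "l \<noteq> l'" "l \<notin> nb S x" "l \<notin> nb S l'" "z1 \<notin> nb S l'" "l \<noteq> x" "z1 \<noteq> l'"
        using ln ln' z1(1) x z1S nb_sym[of l S x] by auto
      ultimately have False using no_far_edges[OF imn, of l' x l z1] x z1S z1(1) by auto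
      then show thesis ..
    next
      case z12: False
      obtain t where t: "t \<noteq> y1" "core S z1 = {y1, t}" using core_other[OF z1S(1,2) yz(1)] by blast
      have tS: "t \<in> S" "cyclic S t" "t \<noteq> z1" using core_in[of t z1] t by auto
      show thesis
      proof (cases "t = z2")
        case True
        have "z1 \<in> core S z2" using core_sym[OF _ z1S(1,2), of z2] t True by auto
        moreover have "z1 \<noteq> y2" using nadj .
        ultimately have "core S z2 = {z1, y2}"
          using core_other[OF z2S(1,2) yz(2)] by (metis insert_commute insert_iff singletonD)
        then show thesis using y z1 z2 y1 y2 z1S z2S z2y1 nadj z12 t True
          by (intro pentagon[of y1 z1 z2 y2]) auto
      next
        case False
        have tz1: "z1 \<in> core S t" using core_sym[OF _ z1S(1,2), of t] t by auto
        have "t \<noteq> x" using tz1 y z1S nadj by auto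
        moreover have "t \<noteq> y2" using tz1 z2 z1(1) z12 by auto
        moreover have "x \<notin> nb S z1" "y2 \<notin> nb S z1" using t x y1 y2 \<open>t \<noteq> x\<close> \<open>t \<noteq> y2\<close> y(2)
          by (auto simp: nb_cyclic)
        moreover have "t \<notin> core S x" "t \<notin> core S y2" using y t z2 False \<open>t \<noteq> x\<close> \<open>t \<noteq> y2\<close> by auto
        then have "x \<notin> nb S t" "y2 \<notin> nb S t"
          using nb_sym[of x S t] nb_sym[of y2 S t] tS by (auto simp: nb_cyclic)
        moreover have "t \<in> nb S z1" "y2 \<in> nb S x" using t y core_in by auto
        ultimately have False
          using no_far_edges[OF imn, of t z1 y2 x] z1S x z1(1) nadj by auto
        then show thesis ..
      qed
    qed
  qed
qed

text \<open>A leaf is adjacent only to its own cycle vertex, so \<open>C\<close> together with its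
  leaves is closed under adjacency.\<close>

lemma closed_core:
  assumes conn: "reach S x = S" and C: "x \<in> C" "C \<subseteq> S" "\<And>z. z \<in> C \<Longrightarrow> cyclic S z \<and> core S z \<subseteq> C"
  shows "S = C \<union> (\<Union>z\<in>C. leaves z)"
proof
  have "reach S x \<subseteq> C \<union> (\<Union>z\<in>C. leaves z)"
  proof (rule reach_closed)
    fix a b assume a: "a \<in> C \<union> (\<Union>z\<in>C. leaves z)" "a \<in> S" and b: "b \<in> nb S a"
    show "b \<in> C \<union> (\<Union>z\<in>C. leaves z)"
    proof (cases "a \<in> C")
      case True
      then show ?thesis using b C(3) by (auto simp: leaves_def)
    next
      case False
      then obtain z where "z \<in> C" "a \<in> leaves z" using a by auto
      then show ?thesis using leaf_nb[of z a] C b by auto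
    qed
  qed (use C in simp)
  then show "S \<subseteq> C \<union> (\<Union>z\<in>C. leaves z)" using conn by simp
qed (use C in \<open>auto simp: leaves_def nb_def\<close>)

text \<open>If the pre-leaf \<open>v\<close> has no exceptional neighbour, the graph is a star.
  Otherwise tightness makes eigenfunctions of \<open>?T\<close> into eigenfunctions of
  \<open>S\<close>, and \<open>component_sum\<close> is applied at \<open>w\<close>, which was
  deleted too: a neighbour of \<open>w\<close> other than \<open>v\<close> with an edge left in
  \<open>?T\<close> would violate the equation at \<open>w\<close>. So these neighbours are
  leaves.\<close>

lemma acyclic_structure:
  assumes acyclic: "\<And>x. x \<in> S \<Longrightarrow> \<not> cyclic S x" and ab: "a \<in> S" "b \<in> nb S a"
    and conn: "\<And>u. u \<in> S \<Longrightarrow> reach S u = S"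
  obtains v w where "v \<in> S" "w \<in> S" "w \<in> nb S v \<or> w = v" "S \<subseteq> {v, w} \<union> nb S v \<union> nb S w"
proof -
  obtain v w where vw: "pre_leaf S v w" using pre_leaf_exists[OF fin acyclic ab] by blast
  let ?T = "S - insert v (nb S v)" and ?E = "{f \<in> eig S. f v = 0}"
  have v: "v \<in> S" and leaf: "\<And>z. z \<in> nb S v \<Longrightarrow> z \<noteq> w \<Longrightarrow> nb S z = {v}"
    using vw by (auto simp: pre_leaf_def)
  show thesis
  proof (cases "w \<in> nb S v")
    case False
    have "reach S v \<subseteq> insert v (nb S v)"
      by (rule reach_closed) (use leaf False in auto)
    then show thesis using conn[OF v] v that[of v v] by blast
  next
    case w: True
    then have wS: "w \<in> S" by (simp add: nb_def)
    have T: "finite ?T" using fin by simp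
    have cycT: "cyc ?T = 0" "cyc S = 0"
      using acyclic cyclic_mono[of ?T S] fin by (auto intro!: cyc_acyclic)
    have "mult S \<le> Suc (fvs.dim ?E)" by (rule mult_le_vanishing[OF fin])
    moreover have "fvs.dim ?E \<le> mult ?T" by (rule mult_remove_closed_nb[OF fin vw])
    moreover have "int (mult ?T) \<le> int (imn ?T)" using mult_le[OF T] cycT by simp
    moreover have "Suc (imn ?T) \<le> imn S" by (rule imn_remove_closed_nb[OF vw])
    moreover have "mult S = imn S" using ext cycT by (simp add: extremal_def)
    ultimately have extT: "extremal ?T" and dim: "mult ?T \<le> fvs.dim ?E"
      using cycT by (auto simp: extremal_def)
    have E: "?E = eig ?T"
      using pre_leaf_vanishing[OF fin vw] dim
      by (intro eig_eq_of_mult[OF T fvs_subspace_vanishing[OF subspace_eig]]) auto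
    have leaf': "nb S c = {w}" if c: "c \<in> nb S w" "c \<noteq> v" for c
    proof -
      have "w \<in> reach (S - {v}) c"
        using nb_sym[OF c(1) wS] c w by (intro reach_step[OF reach_refl]) (auto simp: nb_def)
      moreover have "c \<noteq> w" using c(1) by auto
      ultimately have "c \<notin> nb S v" using acyclic[OF v] w by (auto simp: cyclic_def)
      then have cT: "c \<in> ?T" using c by (auto simp: nb_def)
      have "nb ?T c = {}"
      proof (rule ccontr)
        assume "nb ?T c \<noteq> {}"
        then obtain g where g: "g \<in> eig ?T" "g c \<noteq> 0"
          using extremal_nonvanishing[OF T extT cT] by blast
        have "?T \<subseteq> S - {w}" using w by auto
        then have "reach ?T c \<subseteq> reach (S - {w}) c" by (rule reach_mono)
        moreover have "z \<notin> reach (S - {w}) c" if "z \<in> nb S w" "z \<noteq> c" for z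
          using acyclic[OF wS] that c(1) by (auto simp: cyclic_def)
        ultimately have "z \<notin> reach ?T c" if "z \<in> nb S w" "z \<noteq> c" for z using that by blast
        then obtain h where h: "h \<in> eig ?T" "sum h (nb S w) \<noteq> 0"
          using component_sum[OF fin _ g(1) cT g(2) c(1)] by blast
        then have "h \<in> eig S" using E by blast
        moreover have "h w = 0" using eig_outside[OF h(1)] w by simp
        ultimately show False using eig_eq[of h S w] wS h(2) by simp
      qed
      moreover have "v \<notin> nb S c" using nb_sym[of v S c] \<open>c \<notin> nb S v\<close> cT by blast
      moreover have "z \<notin> nb S c" if "z \<in> nb S v" "z \<noteq> w" for z
        using leaf[OF that] nb_sym[of z S c] cT c by auto
      ultimately have "nb S c \<subseteq> {w}" by (auto simp: nb_Diff)
      then show ?thesis using nb_sym[OF c(1) wS] by blast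
    qed
    have "reach S v \<subseteq> {v, w} \<union> nb S v \<union> nb S w"
    proof (rule reach_closed)
      fix c d assume c: "c \<in> {v, w} \<union> nb S v \<union> nb S w" and d: "d \<in> nb S c"
      then consider "c = v" | "c = w" | "c \<in> nb S v" "c \<noteq> w" | "c \<in> nb S w" "c \<noteq> v" by blast
      then show "d \<in> {v, w} \<union> nb S v \<union> nb S w"
        by cases (use d leaf leaf' in blast)+
    qed simp
    then show thesis using conn[OF v] v wS w that[of v w] by blast
  qed
qed

end

section \<open>Trees and the matrix invariants\<close>

context sgraph
begin

lemma nb_verts: "nb (verts G) u = {v. {u, v} \<in> edges G}"
  using edge_subset by (auto simp: nb_def)

lemma adj_rel_eq_step: "adj_rel G = step (verts G)"
  using edge_subset by (auto simp: adj_rel_def step_def)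

lemma connected_graph_iff:
  "connected_graph G \<longleftrightarrow> verts G \<noteq> {} \<and> (\<forall>u\<in>verts G. reach (verts G) u = verts G)"
proof -
  have "(\<forall>v\<in>verts G. (u, v) \<in> (step (verts G))\<^sup>*) \<longleftrightarrow> reach (verts G) u = verts G"
    if "u \<in> verts G" for u
    using reach_subset[OF that] by (auto simp: reach_def)
  then show ?thesis by (auto simp: connected_graph_def adj_rel_eq_step)
qed

lemma cyclomatic_number_eq: "cyclomatic_number G = cyc (verts G)"
proof -
  have "{e \<in> edges G. e \<subseteq> verts G} = edges G" using edge_subset by blast
  moreover have "{v \<in> verts G. (u, v) \<in> (adj_rel G)\<^sup>*} = reach (verts G) u" if "u \<in> verts G" for u
    using reach_subset[OF that] by (auto simp: adj_rel_eq_step reach_def)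
  then have "graph_components G = reach (verts G) ` verts G"
    unfolding graph_components_def by (rule image_cong[OF refl])
  ultimately show ?thesis by (simp add: cyclomatic_number_def cyc_def)
qed

lemma induced_matching_number_eq: "induced_matching_number G = imn (verts G)"
proof -
  have "is_induced_matching G M \<longleftrightarrow> imatch (verts G) M" for M
    using edge_subset by (auto simp: imatch_def is_induced_matching_def is_matching_def)
  then show ?thesis by (simp add: induced_matching_number_def imn_def)
qed

lemma vertex_list: "distinct (vertex_list G)" "set (vertex_list G) = verts G"
proof -
  have "\<exists>vs. distinct vs \<and> set vs = verts G" using finite_distinct_list[OF finite_verts] by blast
  from someI_ex[OF this] show "distinct (vertex_list G)" "set (vertex_list G) = verts G"
    by (simp_all add: vertex_list_def)
qed

lemma length_vertex_list: "length (vertex_list G) = card (verts G)"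
  using distinct_card[OF vertex_list(1)] vertex_list(2) by simp

lemma adj_matrix_carrier: "adj_matrix G \<in> carrier_mat (card (verts G)) (card (verts G))"
  by (simp add: adj_matrix_def)

lemma eigenvalue_mult_eq:
  fixes x :: real
  assumes "x \<noteq> 0"
  shows "eigenvalue_mult G x = graph_ev.mult G (complex_of_real x) (verts G)"
proof -
  interpret graph_ev G "complex_of_real x" by unfold_locales (simp add: assms)
  let ?V = "verts G" and ?vs = "vertex_list G" and ?lam = "complex_of_real x"
  define n where "n = card ?V"
  define C where "C = char_matrix (map_mat complex_of_real (adj_matrix G)) ?lam"
  have A: "adj_matrix G \<in> carrier_mat n n" using adj_matrix_carrier by (simp add: n_def)
  have C: "C \<in> carrier_mat n n" using A by (simp add: C_def)
  have bij: "bij_betw (\<lambda>j. ?vs ! j) {..<n} ?V"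
    using bij_betw_nth[OF vertex_list(1) _ refl] vertex_list(2) length_vertex_list
    by (simp add: n_def)
  have V: "?V = (\<lambda>j. ?vs ! j) ` {..<n}" using bij by (simp add: bij_betw_def)
  have entry: "C $$ (i, j) = (if {?vs ! i, ?vs ! j} \<in> edges G then 1 else 0) - (if i = j then ?lam else 0)"
    if "i < n" "j < n" for i j
    using that by (simp add: C_def char_matrix_def adj_matrix_def n_def)
  \<comment> \<open>Row \<open>i\<close> of \<open>C\<close> applied to the values of
    \<open>f\<close> is the defect of the eigenvalue equation at the \<open>i\<close>-th
    vertex.\<close>
  have row: "(\<Sum>j<n. C $$ (i, j) * f (?vs ! j)) = sum f (nb ?V (?vs ! i)) - ?lam * f (?vs ! i)"
    if i: "i < n" for i f
  proof -
    have "(\<Sum>j<n. C $$ (i, j) * f (?vs ! j))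
      = (\<Sum>j<n. (if {?vs ! i, ?vs ! j} \<in> edges G then f (?vs ! j) else 0) - (if i = j then ?lam * f (?vs ! i) else 0))"
      using i by (intro sum.cong refl) (simp add: entry algebra_simps)
    also have "\<dots> = (\<Sum>j<n. if {?vs ! i, ?vs ! j} \<in> edges G then f (?vs ! j) else 0) - ?lam * f (?vs ! i)"
      using i by (simp add: sum_subtractf)
    also have "(\<Sum>j<n. if {?vs ! i, ?vs ! j} \<in> edges G then f (?vs ! j) else 0)
      = (\<Sum>v\<in>?V. if {?vs ! i, v} \<in> edges G then f v else 0)"
      by (rule sum.reindex_bij_betw[OF bij])
    also have "\<dots> = sum f (nb ?V (?vs ! i))"
      using finite_verts by (simp add: nb_def sum.inter_filter)
    finally show ?thesis .
  qed
  have "eig ?V = {f \<in> supported (set ?vs). \<forall>i<n. (\<Sum>j<n. C $$ (i, j) * f (?vs ! j)) = 0}"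
  proof -
    have "(\<forall>u\<in>?V. P u) \<longleftrightarrow> (\<forall>i<n. P (?vs ! i))" for P
      unfolding V by auto
    then show ?thesis by (auto simp: eig_def vertex_list(2) row)
  qed
  then have "mult ?V = kernel_dim C"
    using fvs_dim_eq_kernel_dim[OF C vertex_list(1)] length_vertex_list by (simp add: mult_def n_def)
  moreover have "Polynomial.order x (char_poly (adj_matrix G)) = kernel_dim C"
    unfolding C_def by (rule order_char_poly_real_symmetric[OF A])
      (auto simp: adj_matrix_def n_def insert_commute)
  ultimately show ?thesis by (simp add: eigenvalue_mult_def)
qed

lemma eigenvalue_iff_mult: "eigenvalue (adj_matrix G) x \<longleftrightarrow> 0 < eigenvalue_mult G x"
proof -
  have "char_poly (adj_matrix G) \<noteq> 0"
    using degree_monic_char_poly[OF adj_matrix_carrier] by auto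
  then show ?thesis
    using eigenvalue_root_char_poly[OF adj_matrix_carrier] by (simp add: eigenvalue_mult_def order_root)
qed

section \<open>Paths, cycles and acyclicity\<close>

definition is_path :: "'a set \<Rightarrow> 'a list \<Rightarrow> bool" where
  "is_path T p \<longleftrightarrow> p \<noteq> [] \<and> distinct p \<and> set p \<subseteq> T \<and> successively (\<lambda>a b. {a, b} \<in> edges G) p"

lemma reach_path:
  assumes "v \<in> reach T u" "u \<in> T"
  shows "\<exists>p. is_path T p \<and> hd p = u \<and> last p = v"
proof -
  have "(u, v) \<in> (step T)\<^sup>*" using assms(1) by (simp add: reach_def)
  then show ?thesis
  proof (induction rule: rtrancl_induct)
    case base
    show ?case using assms(2) by (intro exI[of _ "[u]"]) (simp add: is_path_def)
  next
    case (step b c)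
    then obtain p where p: "is_path T p" "hd p = u" "last p = b" by blast
    have c: "c \<in> T" "{b, c} \<in> edges G" using step.hyps(2) by (auto simp: step_def)
    show ?case
    proof (cases "c \<in> set p")
      case True
      \<comment> \<open>A walk that returns to \<open>c\<close> is cut back to its earlier visit,
        which keeps the vertices distinct.\<close>
      then obtain p1 p2 where "p = p1 @ c # p2" by (meson split_list)
      then show ?thesis using p
        by (intro exI[of _ "p1 @ [c]"])
          (auto simp: is_path_def successively_append_iff hd_append split: if_splits)
    next
      case False
      then show ?thesis using p c
        by (intro exI[of _ "p @ [c]"]) (auto simp: is_path_def successively_append_iff hd_append)
    qed
  qed
qed

lemma cyclic_imp_is_cycle:
  assumes "cyclic (verts G) x"
  shows "\<exists>vs. is_cycle G vs"
proof -
  let ?T = "verts G - {x}"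
  obtain y z where y: "y \<in> nb (verts G) x" "z \<in> nb (verts G) x" "y \<noteq> z" "z \<in> reach ?T y"
    using assms by (auto simp: cyclic_def)
  then have "y \<in> ?T" by (auto simp: nb_def)
  then obtain p where p: "is_path ?T p" "hd p = y" "last p = z" using reach_path[OF y(4)] by blast
  \<comment> \<open>As \<open>y\<close> and \<open>z\<close> differ, the path has at least two
    vertices, and adding \<open>x\<close> gives a cycle of length at least three.\<close>
  obtain m where m: "length p = Suc (Suc m)"
  proof -
    have "p \<noteq> []" using p by (simp add: is_path_def)
    then have "length p \<noteq> Suc 0" using p y(3) by (auto simp: length_Suc_conv)
    then show thesis using that[of "length p - 2"] \<open>p \<noteq> []\<close> by (cases p; cases "tl p") auto
  qed
  have ends: "p ! 0 = y" "p ! Suc m = z"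
    using p m by (auto simp: is_path_def hd_conv_nth last_conv_nth)
  have succ: "{p ! i, p ! Suc i} \<in> edges G" if "i < Suc m" for i
    using p(1) that m by (auto simp: is_path_def successively_conv_nth)
  have "is_cycle G (x # p)"
    unfolding is_cycle_def
  proof (intro conjI allI impI)
    show "3 \<le> length (x # p)" using m by simp
    show "distinct (x # p)" using p by (auto simp: is_path_def)
    fix i assume i: "i < length (x # p)"
    consider "i = 0" | j where "i = Suc j" "j < Suc m" | "i = Suc (Suc m)"
      using i m by (cases i) (auto simp: less_Suc_eq)
    then show "{(x # p) ! i, (x # p) ! ((i + 1) mod length (x # p))} \<in> edges G"
    proof cases
      case 1
      then show ?thesis using y(1) ends m by (simp add: nb_def)
    next
      case 2
      then show ?thesis using succ m by simp
    next
      case 3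
      then show ?thesis using y(2) ends m by (simp add: nb_def adj_commute)
    qed
  qed
  then show ?thesis by blast
qed

text \<open>The rest of the cycle joins the neighbours \<open>vs ! 1\<close> and
  \<open>vs ! (n - 1)\<close> of \<open>vs ! 0\<close> without passing through it.\<close>

lemma is_cycle_imp_cyclic:
  assumes "is_cycle G vs"
  shows "vs ! 0 \<in> verts G \<and> cyclic (verts G) (vs ! 0)"
proof -
  let ?V = "verts G" and ?x = "vs ! 0"
  define n where "n = length vs"
  have n: "3 \<le> n" and d: "distinct vs" and
    e: "\<And>i. i < n \<Longrightarrow> {vs ! i, vs ! ((i + 1) mod n)} \<in> edges G"
    using assms by (auto simp: is_cycle_def n_def)
  have nb: "vs ! Suc i \<in> nb ?V (vs ! i)" if "Suc i < n" for i
    using e[of i] that by (simp add: nb_verts)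
  have neq: "vs ! i \<noteq> ?x" if "0 < i" "i < n" for i
  proof
    assume "vs ! i = ?x"
    moreover have "0 < length vs" using n unfolding n_def by linarith
    ultimately have "i = 0" using nth_eq_iff_index_eq[OF d] that(2) by (metis n_def)
    then show False using that(1) by simp
  qed
  have "vs ! Suc i \<in> reach (?V - {?x}) (vs ! 1)" if "Suc i < n" for i
    using that
  proof (induction i)
    case (Suc i)
    then have "vs ! Suc i \<in> ?V - {?x}" using nb[of i] neq[of "Suc i"] by (auto simp: nb_def)
    moreover have "vs ! Suc (Suc i) \<in> nb (?V - {?x}) (vs ! Suc i)"
      using nb[of "Suc i"] neq[of "Suc (Suc i)"] Suc.prems by (simp add: nb_Diff)
    moreover have "vs ! Suc i \<in> reach (?V - {?x}) (vs ! 1)" using Suc by simp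
    ultimately show ?case using reach_step by blast
  qed simp
  from this[of "n - 2"] have "vs ! (n - 1) \<in> reach (?V - {?x}) (vs ! 1)"
    using n by (simp add: numeral_2_eq_2 Suc_diff_Suc)
  moreover have "vs ! (n - 1) \<in> nb ?V ?x"
    using e[of "n - 1"] n by (simp add: nb_verts adj_commute)
  moreover have "vs ! 1 \<in> nb ?V ?x" using nb[of 0] n by simp
  moreover have "vs ! 1 \<noteq> vs ! (n - 1)" using d n by (simp add: n_def nth_eq_iff_index_eq)
  moreover have "?x \<in> ?V"
  proof -
    have "0 < n" using n by linarith
    then show ?thesis using edge_subset[OF e[of 0]] by simp
  qed
  ultimately show ?thesis unfolding cyclic_def by blast
qed

lemma is_tree_iff:
  "is_tree G \<longleftrightarrow> connected_graph G \<and> (\<forall>x\<in>verts G. \<not> cyclic (verts G) x)"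
  using cyclic_imp_is_cycle is_cycle_imp_cyclic by (auto simp: is_tree_def)

section \<open>Distances and the diameter\<close>

lemma graph_dist_relpow:
  assumes "connected_graph G" "u \<in> verts G" "v \<in> verts G"
  shows "(u, v) \<in> adj_rel G ^^ graph_dist G u v"
proof -
  have "\<exists>n. (u, v) \<in> adj_rel G ^^ n"
    using assms by (auto simp: connected_graph_def dest: rtrancl_imp_relpow)
  then show ?thesis unfolding graph_dist_def by (rule LeastI_ex)
qed

lemma graph_dist_le: "(u, v) \<in> adj_rel G ^^ n \<Longrightarrow> graph_dist G u v \<le> n"
  unfolding graph_dist_def by (rule Least_le)

lemma graph_dist_le_diameter:
  "u \<in> verts G \<Longrightarrow> v \<in> verts G \<Longrightarrow> graph_dist G u v \<le> graph_diameter G"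
  unfolding graph_diameter_def using finite_verts by (intro Max_ge) auto

lemma diameter_attained:
  assumes "verts G \<noteq> {}"
  obtains u v where "u \<in> verts G" "v \<in> verts G" "graph_diameter G = graph_dist G u v"
proof -
  have "graph_diameter G \<in> (\<lambda>(u, v). graph_dist G u v) ` (verts G \<times> verts G)"
    unfolding graph_diameter_def using finite_verts assms by (intro Max_in) auto
  then show thesis using that by auto
qed

lemma diameter_pos_iff:
  assumes "connected_graph G"
  shows "0 < graph_diameter G \<longleftrightarrow> (\<exists>a\<in>verts G. nb (verts G) a \<noteq> {})"
proof
  assume pos: "0 < graph_diameter G"
  obtain u v where uv: "u \<in> verts G" "v \<in> verts G" "graph_diameter G = graph_dist G u v"
    using diameter_attained assms by (auto simp: connected_graph_def)
  have "u \<noteq> v" using uv(3) pos graph_dist_le[of u u 0] by auto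
  have "nb (verts G) u \<noteq> {}"
  proof
    assume "nb (verts G) u = {}"
    then have "reach (verts G) u \<subseteq> {u}" by (intro reach_closed) auto
    then show False using assms uv \<open>u \<noteq> v\<close> by (auto simp: connected_graph_iff)
  qed
  then show "\<exists>a\<in>verts G. nb (verts G) a \<noteq> {}" using uv by blast
next
  assume "\<exists>a\<in>verts G. nb (verts G) a \<noteq> {}"
  then obtain a b where ab: "a \<in> verts G" "b \<in> nb (verts G) a" by blast
  then have b: "b \<in> verts G" "a \<noteq> b" by (auto simp: nb_def)
  have "graph_dist G a b \<noteq> 0"
  proof
    assume "graph_dist G a b = 0"
    then show False using graph_dist_relpow[OF assms ab(1) b(1)] b(2) by simp
  qed
  then show "0 < graph_diameter G" using graph_dist_le_diameter[OF ab(1) b(1)] by simp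
qed

text \<open>Any two vertices are joined through \<open>v\<close> or \<open>w\<close> in three pieces
  of length at most one: to the edge, along it, and away from it.\<close>

lemma diameter_le_3:
  assumes ne: "verts G \<noteq> {}" and vw: "w \<in> nb (verts G) v \<or> w = v"
    and V: "verts G \<subseteq> {v, w} \<union> nb (verts G) v \<union> nb (verts G) w"
  shows "graph_diameter G \<le> 3"
proof -
  let ?R = "adj_rel G"
  have adj: "(a, b) \<in> ?R \<longleftrightarrow> b \<in> nb (verts G) a" for a b by (simp add: adj_rel_def nb_verts)
  have sym: "(a, b) \<in> ?R \<Longrightarrow> (b, a) \<in> ?R" for a b by (simp add: adj_rel_def adj_commute)
  have near: "\<exists>c\<in>{v, w}. \<exists>n\<le>1. (u, c) \<in> ?R ^^ n \<and> (c, u) \<in> ?R ^^ n" if uV: "u \<in> verts G" for u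
  proof -
    consider "u \<in> {v, w}" | "u \<in> nb (verts G) v" | "u \<in> nb (verts G) w" using uV V by blast
    then show ?thesis
    proof cases
      case 1
      then show ?thesis by (intro bexI[of _ u] exI[of _ 0]) auto
    next
      case 2
      then show ?thesis using adj sym by (intro bexI[of _ v] exI[of _ 1]) auto
    next
      case 3
      then show ?thesis using adj sym by (intro bexI[of _ w] exI[of _ 1]) auto
    qed
  qed
  have mid: "\<exists>n\<le>1. (c, d) \<in> ?R ^^ n" if "c \<in> {v, w}" "d \<in> {v, w}" for c d
  proof (cases "c = d")
    case True
    then show ?thesis by (intro exI[of _ 0]) auto
  next
    case False
    then show ?thesis using that vw adj sym by (intro exI[of _ 1]) auto
  qed
  obtain u u' where u: "u \<in> verts G" "u' \<in> verts G" "graph_diameter G = graph_dist G u u'"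
    using diameter_attained[OF ne] by blast
  obtain c k where c: "c \<in> {v, w}" "k \<le> 1" "(u, c) \<in> ?R ^^ k" using near[OF u(1)] by blast
  obtain d l where d: "d \<in> {v, w}" "l \<le> 1" "(d, u') \<in> ?R ^^ l" using near[OF u(2)] by blast
  obtain m where m: "m \<le> 1" "(c, d) \<in> ?R ^^ m" using mid[OF c(1) d(1)] by blast
  have "(u, u') \<in> ?R ^^ (k + m + l)" unfolding relpow_add using c(3) m(2) d(3) by blast
  then have "graph_dist G u u' \<le> k + m + l" by (rule graph_dist_le)
  then show ?thesis using u(3) c(2) d(2) m(1) by simp
qed

lemma imn_le_1I:
  assumes "\<And>e f. e \<in> edges G \<Longrightarrow> f \<in> edges G \<Longrightarrow> e \<inter> f = {} \<Longrightarrow> \<exists>u\<in>e. \<exists>v\<in>f. {u, v} \<in> edges G"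
  shows "imn S \<le> 1"
proof -
  obtain M where M: "imatch S M" "card M = imn S" by (rule imn_obtain)
  have "e = f" if "e \<in> M" "f \<in> M" for e f
  proof (rule ccontr)
    assume "e \<noteq> f"
    then have "e \<in> edges G" "f \<in> edges G" "e \<inter> f = {}" "\<not> (\<exists>u\<in>e. \<exists>v\<in>f. {u, v} \<in> edges G)"
      using M(1) that unfolding imatch_def is_induced_matching_def is_matching_def by blast+
    then show False using assms by blast
  qed
  moreover have "finite M" using imatch_edges[OF M(1)] finite_edges by (rule finite_subset)
  ultimately have "card M \<le> 1" by (simp add: card_le_Suc0_iff_eq)
  then show ?thesis using M(2) by simp
qed

text \<open>Every edge contains \<open>v\<close> or its neighbour \<open>w\<close>, so two disjoint
  edges are linked by the edge \<open>{v, w}\<close>.\<close>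

lemma tree_imn_le_1:
  assumes tree: "is_tree G" and diam: "graph_diameter G \<le> 3" and ab: "a \<in> verts G" "b \<in> nb (verts G) a"
  shows "imn S \<le> 1"
proof -
  let ?V = "verts G"
  have acyclic: "\<not> cyclic ?V x" if "x \<in> ?V" for x using tree that by (simp add: is_tree_iff)
  have conn: "connected_graph G" using tree by (simp add: is_tree_def)
  obtain v w where vw: "pre_leaf ?V v w"
    using pre_leaf_exists[OF finite_verts acyclic ab] by blast
  then have v: "v \<in> ?V" and leaf: "\<And>z. z \<in> nb ?V v \<Longrightarrow> z \<noteq> w \<Longrightarrow> nb ?V z = {v}"
    by (auto simp: pre_leaf_def)
  obtain y where y: "y \<in> nb ?V v" "y \<noteq> w" using vw by (auto simp: pre_leaf_def)
  have yV: "y \<in> ?V" using y by (simp add: nb_def)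
  have adj: "(a, b) \<in> adj_rel G \<longleftrightarrow> b \<in> nb ?V a" for a b by (simp add: adj_rel_def nb_verts)
  \<comment> \<open>Distances are measured from a leaf \<open>y\<close> at \<open>v\<close>: a walk
    from \<open>y\<close> spends its first step reaching \<open>v\<close>, and of the two steps left
    only one through \<open>w\<close> can lead beyond the neighbours of \<open>v\<close>.\<close>
  have cover: "z = v \<or> z \<in> nb ?V v \<or> w \<in> nb ?V v \<and> z \<in> nb ?V w" if z: "z \<in> ?V" for z
  proof -
    define n where "n = graph_dist G y z"
    have yz: "(y, z) \<in> adj_rel G ^^ n"
      unfolding n_def by (rule graph_dist_relpow[OF conn yV z])
    have "n \<le> 3" using graph_dist_le_diameter[OF yV z] diam by (simp add: n_def)
    then consider "n = 0" | "n = 1" | "n = 2" | "n = 3" by linarith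
    then show ?thesis
    proof cases
      case 1
      then show ?thesis using yz y by simp
    next
      case 2
      then show ?thesis using yz leaf[OF y] by (simp add: adj)
    next
      case 3
      then obtain c where "(y, c) \<in> adj_rel G" "(c, z) \<in> adj_rel G"
        using yz by (auto simp: numeral_2_eq_2)
      then show ?thesis using leaf[OF y] by (simp add: adj)
    next
      case 4
      then obtain c b where "(y, c) \<in> adj_rel G" "(c, b) \<in> adj_rel G" "(b, z) \<in> adj_rel G"
        using yz by (auto simp: numeral_3_eq_3)
      then have b: "b \<in> nb ?V v" "z \<in> nb ?V b" using leaf[OF y] by (simp_all add: adj)
      then show ?thesis using leaf[of b] by (cases "b = w") simp_all
    qed
  qed
  have hit: "v \<in> e \<or> w \<in> nb ?V v \<and> w \<in> e" if e: "e \<in> edges G" for e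
  proof (rule ccontr)
    assume not: "\<not> ?thesis"
    obtain c d where cd: "e = {c, d}" "c \<noteq> d" using card_edge[OF e] by (auto simp: card_2_iff)
    \<comment> \<open>Both endpoints of an edge avoiding \<open>v\<close> and \<open>w\<close> turn
      out to be neighbours of \<open>w\<close>, which gives a triangle.\<close>
    have far: "w \<in> nb ?V v \<and> p \<in> nb ?V w" if p: "p \<in> e" for p
    proof -
      have "p \<notin> nb ?V v"
      proof
        assume pv: "p \<in> nb ?V v"
        then have "nb ?V p = {v}" using leaf not p by blast
        moreover obtain q where "e = {p, q}" using p cd by auto
        ultimately show False using e not by (auto simp: nb_verts)
      qed
      then show ?thesis using cover[of p] p not edge_subset[OF e] by blast
    qed
    have "c \<in> ?V" "d \<in> ?V" using edge_subset[OF e] cd by auto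
    moreover have "c \<noteq> w" "d \<noteq> w" using far[of c] far[of d] cd by auto
    ultimately have "d \<in> reach (?V - {w}) c"
      using e cd by (intro reach_step[OF reach_refl]) (auto simp: nb_def)
    moreover have "w \<in> ?V" using far[of c] cd by (auto simp: nb_def)
    ultimately show False using acyclic[of w] far[of c] far[of d] cd by (auto simp: cyclic_def)
  qed
  show ?thesis
  proof (rule imn_le_1I)
    fix e f assume ef: "e \<in> edges G" "f \<in> edges G" "e \<inter> f = {}"
    then consider "v \<in> e" "w \<in> f" "w \<in> nb ?V v" | "v \<in> f" "w \<in> e" "w \<in> nb ?V v"
      using hit[OF ef(1)] hit[OF ef(2)] by blast
    then show "\<exists>u\<in>e. \<exists>v\<in>f. {u, v} \<in> edges G"
    proof cases
      case 1
      then show ?thesis by (auto simp: nb_verts)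
    next
      case 2
      then have "{w, v} \<in> edges G" by (simp add: nb_verts adj_commute)
      then show ?thesis using 2 by blast
    qed
  qed
qed

end

section \<open>The extremal cyclic graphs\<close>

lemma edges_C5: "edges (cycle_graph 5) = {{0, 1}, {1, 2}, {2, 3}, {3, 4}, {4, 0}}"
proof -
  have "{..<5::nat} = {0, 1, 2, 3, 4}" by auto
  then show ?thesis by (simp add: cycle_graph_def numeral_2_eq_2)
qed

lemma edges_C3: "edges (cycle_graph 3) = {{0, 1}, {1, 2}, {2, 0}}"
proof -
  have "{..<3::nat} = {0, 1, 2}" by auto
  then show ?thesis by (simp add: cycle_graph_def numeral_2_eq_2)
qed

lemma less_5: "(i::nat) < 5 \<longleftrightarrow> i = 0 \<or> i = 1 \<or> i = 2 \<or> i = 3 \<or> i = 4"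
  by auto

lemma less_3: "(i::nat) < 3 \<longleftrightarrow> i = 0 \<or> i = 1 \<or> i = 2"
  by auto

lemma verts_C5: "verts (cycle_graph 5) = {..<5}"
  by (simp add: cycle_graph_def)

lemma nbs_C5:
  "{q \<in> verts (cycle_graph 5). {0, q} \<in> edges (cycle_graph 5)} = {1, 4}"
  "{q \<in> verts (cycle_graph 5). {1, q} \<in> edges (cycle_graph 5)} = {0, 2}"
  "{q \<in> verts (cycle_graph 5). {2, q} \<in> edges (cycle_graph 5)} = {1, 3}"
  "{q \<in> verts (cycle_graph 5). {3, q} \<in> edges (cycle_graph 5)} = {2, 4}"
  "{q \<in> verts (cycle_graph 5). {4, q} \<in> edges (cycle_graph 5)} = {3, 0}"
  unfolding verts_C5 edges_C5 by (auto simp: doubleton_eq_iff)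

lemma nb_C3_pendant:
  "{(i, j), (k, l)} \<in> edges (C3_pendant a) \<longleftrightarrow> i < 3 \<and> k < 3 \<and>
    (j = 0 \<and> l = 0 \<and> i \<noteq> k \<or> i = k \<and> (j = 0 \<and> 1 \<le> l \<and> l \<le> a \<or> l = 0 \<and> 1 \<le> j \<and> j \<le> a))"
proof -
  have "{(i, j), (k, l)} \<in> (\<lambda>e. (\<lambda>i. (i, 0)) ` e) ` edges (cycle_graph 3)
    \<longleftrightarrow> i < 3 \<and> k < 3 \<and> j = 0 \<and> l = 0 \<and> i \<noteq> k"
    unfolding edges_C3 less_3 by (auto simp: doubleton_eq_iff)
  moreover have "{(i, j), (k, l)} \<in> {{(i, 0), (i, j)} | i j. i < 3 \<and> 1 \<le> j \<and> j \<le> a}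
    \<longleftrightarrow> i < 3 \<and> k < 3 \<and> i = k \<and> (j = 0 \<and> 1 \<le> l \<and> l \<le> a \<or> l = 0 \<and> 1 \<le> j \<and> j \<le> a)"
    by (auto simp: doubleton_eq_iff)
  ultimately show ?thesis by (auto simp: C3_pendant_def)
qed

text \<open>The map from the concrete graph to \<open>G\<close> is the convenient direction: it can
  be given by cases on explicit vertices.\<close>

lemma graph_iso_inverse:
  "graph_iso G H \<longleftrightarrow> (\<exists>F. bij_betw F (verts H) (verts G) \<and>
    (\<forall>p\<in>verts H. \<forall>q\<in>verts H. {F p, F q} \<in> edges G \<longleftrightarrow> {p, q} \<in> edges H))"
proof
  assume "graph_iso G H"
  then obtain f where f: "bij_betw f (verts G) (verts H)"
    "\<And>u v. u \<in> verts G \<Longrightarrow> v \<in> verts G \<Longrightarrow> {u, v} \<in> edges G \<longleftrightarrow> {f u, f v} \<in> edges H"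
    by (auto simp: graph_iso_def)
  let ?F = "inv_into (verts G) f"
  have "?F p \<in> verts G" "f (?F p) = p" if "p \<in> verts H" for p
    using f(1) that by (auto simp: bij_betw_def inv_into_into f_inv_into_f)
  then show "\<exists>F. bij_betw F (verts H) (verts G) \<and>
    (\<forall>p\<in>verts H. \<forall>q\<in>verts H. {F p, F q} \<in> edges G \<longleftrightarrow> {p, q} \<in> edges H)"
    using bij_betw_inv_into[OF f(1)] f(2) by (intro exI[of _ ?F]) simp
next
  assume "\<exists>F. bij_betw F (verts H) (verts G) \<and>
    (\<forall>p\<in>verts H. \<forall>q\<in>verts H. {F p, F q} \<in> edges G \<longleftrightarrow> {p, q} \<in> edges H)"
  then obtain F where F: "bij_betw F (verts H) (verts G)"
    "\<And>p q. p \<in> verts H \<Longrightarrow> q \<in> verts H \<Longrightarrow> {F p, F q} \<in> edges G \<longleftrightarrow> {p, q} \<in> edges H"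
    by auto
  let ?f = "inv_into (verts H) F"
  have "?f u \<in> verts H" "F (?f u) = u" if "u \<in> verts G" for u
    using F(1) that by (auto simp: bij_betw_def inv_into_into f_inv_into_f)
  then have "{u, v} \<in> edges G \<longleftrightarrow> {?f u, ?f v} \<in> edges H" if "u \<in> verts G" "v \<in> verts G" for u v
    using F(2)[of "?f u" "?f v"] that by simp
  then show "graph_iso G H" unfolding graph_iso_def using bij_betw_inv_into[OF F(1)] by blast
qed

context sgraph
begin

lemma iso_edges:
  assumes F: "bij_betw F (verts H) (verts G)"
    and adj: "\<And>p q. p \<in> verts H \<Longrightarrow> q \<in> verts H \<Longrightarrow> {F p, F q} \<in> edges G \<longleftrightarrow> {p, q} \<in> edges H"
    and e: "e \<in> edges G"
  obtains p q where "p \<in> verts H" "q \<in> verts H" "{p, q} \<in> edges H" "e = {F p, F q}"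
proof -
  obtain u v where uv: "e = {u, v}" using card_edge[OF e] by (auto simp: card_2_iff)
  then have "u \<in> verts G" "v \<in> verts G" using edge_subset[OF e] by auto
  moreover have "verts G = F ` verts H" using F by (simp add: bij_betw_def)
  ultimately obtain p q where pq: "p \<in> verts H" "q \<in> verts H" "u = F p" "v = F q" by blast
  then show thesis using that[of p q] adj[of p q] e uv by simp
qed

lemma iso_cyc_le:
  assumes F: "bij_betw F (verts H) (verts G)"
    and adj: "\<And>p q. p \<in> verts H \<Longrightarrow> q \<in> verts H \<Longrightarrow> {F p, F q} \<in> edges G \<longleftrightarrow> {p, q} \<in> edges H"
    and conn: "connected_graph G" and fin: "finite (edges H)"
  shows "cyc (verts G) \<le> int (card (edges H)) - int (card (verts H)) + 1"
proof -
  have "edges G \<subseteq> (`) F ` edges H"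
  proof
    fix e assume "e \<in> edges G"
    then obtain p q where "{p, q} \<in> edges H" "e = {F p, F q}" using iso_edges[OF F adj] by metis
    then show "e \<in> (`) F ` edges H" by (intro image_eqI[of _ _ "{p, q}"]) auto
  qed
  then have "card (edges G) \<le> card (edges H)" using fin surj_card_le by blast
  moreover have "card (verts H) = card (verts G)" by (rule bij_betw_same_card[OF F])
  moreover have "{e \<in> edges G. e \<subseteq> verts G} = edges G" using edge_subset by blast
  moreover have "reach (verts G) ` verts G = {verts G}" using conn by (auto simp: connected_graph_iff)
  ultimately show ?thesis by (simp add: cyc_def)
qed

lemma iso_imn_le_1:
  assumes F: "bij_betw F (verts H) (verts G)"
    and adj: "\<And>p q. p \<in> verts H \<Longrightarrow> q \<in> verts H \<Longrightarrow> {F p, F q} \<in> edges G \<longleftrightarrow> {p, q} \<in> edges H"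
    and H: "\<And>e f. e \<in> edges H \<Longrightarrow> f \<in> edges H \<Longrightarrow> e \<inter> f = {} \<Longrightarrow> \<exists>u\<in>e. \<exists>v\<in>f. {u, v} \<in> edges H"
  shows "imn S \<le> 1"
proof (rule imn_le_1I)
  fix e f assume ef: "e \<in> edges G" "f \<in> edges G" "e \<inter> f = {}"
  obtain p q where p: "p \<in> verts H" "q \<in> verts H" "{p, q} \<in> edges H" "e = {F p, F q}"
    using iso_edges[OF F adj ef(1)] .
  obtain r s where r: "r \<in> verts H" "s \<in> verts H" "{r, s} \<in> edges H" "f = {F r, F s}"
    using iso_edges[OF F adj ef(2)] .
  have "{p, q} \<inter> {r, s} = {}" using ef(3) p(4) r(4) by auto
  then obtain u v where uv: "u \<in> {p, q}" "v \<in> {r, s}" "{u, v} \<in> edges H" using H[OF p(3) r(3)] by blast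
  then have "{F u, F v} \<in> edges G" using adj[of u v] p(1,2) r(1,2) by blast
  then show "\<exists>u\<in>e. \<exists>v\<in>f. {u, v} \<in> edges G" using uv(1,2) p(4) r(4) by blast
qed

end

context graph_ev
begin

lemma iso_eig:
  assumes F: "bij_betw F (verts H) (verts G)"
    and adj: "\<And>p q. p \<in> verts H \<Longrightarrow> q \<in> verts H \<Longrightarrow> {F p, F q} \<in> edges G \<longleftrightarrow> {p, q} \<in> edges H"
    and h: "\<And>p. p \<in> verts H \<Longrightarrow> lam * h p = sum h {q \<in> verts H. {p, q} \<in> edges H}"
  obtains f where "f \<in> eig (verts G)" "\<And>p. p \<in> verts H \<Longrightarrow> f (F p) = h p"
proof
  define f where "f = (\<lambda>u. if u \<in> verts G then h (inv_into (verts H) F u) else 0)"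
  have inj: "inj_on F (verts H)" and img: "F ` verts H = verts G" using F by (auto simp: bij_betw_def)
  show fF: "f (F p) = h p" if "p \<in> verts H" for p
    using that inj img by (auto simp: f_def)
  have "lam * f (F p) = sum f (nb (verts G) (F p))" if p: "p \<in> verts H" for p
  proof -
    let ?N = "{q \<in> verts H. {p, q} \<in> edges H}"
    have "nb (verts G) (F p) = F ` ?N"
      unfolding img[symmetric] nb_def using adj[OF p] by auto
    moreover have "inj_on F ?N" using inj by (rule inj_on_subset) auto
    ultimately have "sum f (nb (verts G) (F p)) = (\<Sum>q\<in>?N. f (F q))" by (simp add: sum.reindex)
    also have "\<dots> = sum h ?N" using fF by (intro sum.cong) auto
    finally show ?thesis using h[OF p] fF[OF p] by simp
  qed
  then have "\<forall>u\<in>verts G. lam * f u = sum f (nb (verts G) u)" unfolding img[symmetric] by blast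
  moreover have "f \<in> supported (verts G)" by (simp add: supported_def f_def)
  ultimately show "f \<in> eig (verts G)" by (simp add: eig_def)
qed

lemma mult_ge_2:
  assumes S: "finite S" and f: "f \<in> eig S" "f u \<noteq> 0" and g: "g \<in> eig S" "g u = 0" "g v \<noteq> 0"
  shows "2 \<le> mult S"
proof -
  let ?E = "{f \<in> eig S. f u = 0}"
  have "fvs.dim ?E = Suc (fvs.dim {f \<in> ?E. f v = 0})"
    using eig_supported g
    by (intro fvs_dim_vanishing[OF S _ fvs_subspace_vanishing[OF subspace_eig], where f = g]) auto
  then show ?thesis using mult_eq_vanishing[OF S f] by simp
qed

end

text \<open>The chain \<open>2 \<le> mult \<le> imn + cyc \<le> 1 + 1\<close> collapses to equality,
  so the examples need only these crude bounds; positive multiplicity makes \<open>y\<close> an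
  eigenvalue.\<close>

lemma sgraph_extremalI:
  fixes y :: real
  assumes G: "simple_graph G" "connected_graph G" and y: "y \<noteq> 0"
    and "2 \<le> graph_ev.mult G (complex_of_real y) (verts G)"
    and "sgraph.imn G (verts G) \<le> 1" and "sgraph.cyc G (verts G) \<le> 1"
  shows "eigenvalue (adj_matrix G) y \<and>
    int (eigenvalue_mult G y) = int (induced_matching_number G) + cyclomatic_number G"
proof -
  interpret graph_ev G "complex_of_real y" by unfold_locales (use G y in simp_all)
  have "int (mult (verts G)) \<le> int (imn (verts G)) + cyc (verts G)" by (rule mult_le[OF finite_verts])
  then show ?thesis using assms(4-6)
    by (simp add: eigenvalue_iff_mult eigenvalue_mult_eq[OF y] induced_matching_number_eq cyclomatic_number_eq)
qed

lemma iso_C5_extremal: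
  fixes G :: "'a ugraph"
  assumes G: "simple_graph G" "connected_graph G" and iso: "graph_iso G (cycle_graph 5)"
  shows "\<exists>y. y \<noteq> 0 \<and> eigenvalue (adj_matrix G) y \<and>
    int (eigenvalue_mult G y) = int (induced_matching_number G) + cyclomatic_number G"
proof -
  let ?H = "cycle_graph 5"
  \<comment> \<open>This is twice the cosine of 72 degrees, a double eigenvalue of the pentagon and
    a root of \<open>y * y + y = 1\<close>.\<close>
  define y :: real where "y = (sqrt 5 - 1) / 2"
  have yy: "y * y = 1 - y" by (simp add: y_def field_simps)
  then have y: "y \<noteq> 0" by auto
  interpret graph_ev G "complex_of_real y" by unfold_locales (use G y in simp_all)
  define c where "c = complex_of_real y"
  have cc: "c * c = 1 - c" unfolding c_def by (metis of_real_1 of_real_diff of_real_mult yy)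
  obtain F where F: "bij_betw F (verts ?H) (verts G)" and
    adj: "\<And>p q. p \<in> verts ?H \<Longrightarrow> q \<in> verts ?H \<Longrightarrow> {F p, F q} \<in> edges G \<longleftrightarrow> {p, q} \<in> edges ?H"
    using iso unfolding graph_iso_inverse by blast
  note vH = verts_C5
  \<comment> \<open>Around the cycle the equation is the recurrence
    \<open>h (p + 1) = c * h p - h (p - 1)\<close>. Starting with 1, 0 gives \<open>h1\<close>, and
    \<open>cc\<close> makes it close up after five steps; \<open>h2\<close> is \<open>h1\<close>
    rotated by one.\<close>
  define h1 where "h1 = (\<lambda>p::nat. if p = 0 then 1 else if p = 1 then 0 else if p = 2 then -1 else if p = 3 then -c else c)"
  define h2 where "h2 = (\<lambda>p::nat. if p = 0 then c else if p = 1 then 1 else if p = 2 then 0 else if p = 3 then -1 else -c)"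
  have h1: "c * h1 p = sum h1 {q \<in> verts ?H. {p, q} \<in> edges ?H}" if p: "p \<in> verts ?H" for p
  proof -
    consider "p = 0" | "p = 1" | "p = 2" | "p = 3" | "p = 4" using p by (auto simp: vH less_5)
    then show ?thesis by cases (simp_all only: nbs_C5, simp_all add: h1_def cc)
  qed
  have h2: "c * h2 p = sum h2 {q \<in> verts ?H. {p, q} \<in> edges ?H}" if p: "p \<in> verts ?H" for p
  proof -
    consider "p = 0" | "p = 1" | "p = 2" | "p = 3" | "p = 4" using p by (auto simp: vH less_5)
    then show ?thesis by cases (simp_all only: nbs_C5, simp_all add: h2_def cc)
  qed
  obtain f1 where f1: "f1 \<in> eig (verts G)" "\<And>p. p \<in> verts ?H \<Longrightarrow> f1 (F p) = h1 p"
    using iso_eig[OF F adj h1[unfolded c_def]] by blast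
  obtain f2 where f2: "f2 \<in> eig (verts G)" "\<And>p. p \<in> verts ?H \<Longrightarrow> f2 (F p) = h2 p"
    using iso_eig[OF F adj h2[unfolded c_def]] by blast
  have "2 \<le> mult (verts G)"
    using f1 f2 by (intro mult_ge_2[OF finite_verts, of f2 "F 1" f1 "F 0"]) (simp_all add: vH h1_def h2_def)
  moreover have "imn (verts G) \<le> 1"
  proof (rule iso_imn_le_1[OF F adj])
    fix e f assume "e \<in> edges ?H" "f \<in> edges ?H" "e \<inter> f = {}"
    then show "\<exists>u\<in>e. \<exists>v\<in>f. {u, v} \<in> edges ?H"
      unfolding edges_C5 by (elim insertE emptyE) (simp_all add: doubleton_eq_iff)
  qed
  moreover have "cyc (verts G) \<le> 1"
  proof -
    have "card (edges ?H) \<le> 5" "finite (edges ?H)"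
      using card_image_le[of "{..<5::nat}" "\<lambda>i. {i, (i + 1) mod 5}"] by (simp_all add: cycle_graph_def)
    then show ?thesis using iso_cyc_le[OF F adj G(2)] by (simp add: vH)
  qed
  ultimately show ?thesis using sgraph_extremalI[OF G y] y by blast
qed

lemma iso_C3_pendant_extremal:
  fixes G :: "'a ugraph"
  assumes G: "simple_graph G" "connected_graph G" and iso: "graph_iso G (C3_pendant a)"
  shows "\<exists>y. y \<noteq> 0 \<and> eigenvalue (adj_matrix G) y \<and>
    int (eigenvalue_mult G y) = int (induced_matching_number G) + cyclomatic_number G"
proof -
  let ?H = "C3_pendant a"
  \<comment> \<open>The negative root of \<open>y * y + y = a\<close> is taken because the other
    root is zero for \<open>a = 0\<close>.\<close>
  define y :: real where "y = - (1 + sqrt (1 + 4 * real a)) / 2"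
  have yy: "y * y + y = a" by (simp add: y_def field_simps)
  have "0 < 1 + sqrt (1 + 4 * real a)" by (intro add_pos_nonneg) auto
  then have y: "y \<noteq> 0" by (simp only: y_def) simp
  interpret graph_ev G "complex_of_real y" by unfold_locales (use G y in simp_all)
  define c where "c = complex_of_real y"
  have cc: "c * c + c = of_nat a"
    unfolding c_def by (metis of_real_add of_real_mult of_real_of_nat_eq yy)
  have c0: "c \<noteq> 0" using y by (simp add: c_def)
  obtain F where F: "bij_betw F (verts ?H) (verts G)" and
    adj: "\<And>p q. p \<in> verts ?H \<Longrightarrow> q \<in> verts ?H \<Longrightarrow> {F p, F q} \<in> edges G \<longleftrightarrow> {p, q} \<in> edges ?H"
    using iso unfolding graph_iso_inverse by blast
  have vH: "verts ?H = {..<3} \<times> {..a}" by (simp add: C3_pendant_def)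
  have ex: "\<exists>f\<in>eig (verts G). \<forall>i<3. f (F (i, 0)) = t i" if t: "t 0 + t 1 + t 2 = 0" for t :: "nat \<Rightarrow> complex"
  proof -
    have t3: "sum t {..<3} = 0"
      using t by (simp add: numeral_3_eq_3 numeral_2_eq_2 lessThan_Suc add_ac)
    \<comment> \<open>The value at a leaf is forced by its own equation. At a triangle vertex the
      other two corners sum to \<open>- t i\<close>, so the equation becomes
      \<open>c * t i = - t i + a * t i / c\<close>, which is \<open>cc\<close>.\<close>
    define h where "h = (\<lambda>(i, j). if j = (0::nat) then t i else t i / c)"
    have "c * h p = sum h {q \<in> verts ?H. {p, q} \<in> edges ?H}" if p: "p \<in> verts ?H" for p
    proof (cases p)
      case (Pair i j)
      have i: "i < 3" "j \<le> a" using p Pair by (auto simp: vH)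
      show ?thesis
      proof (cases "j = 0")
        case True
        have "{q \<in> verts ?H. {p, q} \<in> edges ?H} = ({..<3} - {i}) \<times> {0} \<union> {i} \<times> {1..a}"
          using i unfolding Pair True by (auto simp: vH nb_C3_pendant)
        moreover have "sum h (({..<3} - {i}) \<times> {0} \<union> {i} \<times> {1..a})
          = sum h (({..<3} - {i}) \<times> {0}) + sum h ({i} \<times> {1..a})"
          by (intro sum.union_disjoint) auto
        moreover have "sum h (({..<3} - {i}) \<times> {0}) = sum t ({..<3} - {i})"
          by (subst sum.cartesian_product[symmetric, of "\<lambda>i j. h (i, j)", simplified]) (simp add: h_def)
        moreover have "sum t ({..<3} - {i}) = - t i"
          using t3 i by (simp add: sum_diff1)
        moreover have "sum h ({i} \<times> {1..a}) = of_nat a * (t i / c)"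
          by (subst sum.cartesian_product[symmetric, of "\<lambda>i j. h (i, j)", simplified]) (simp add: h_def)
        moreover have "c * t i = - t i + of_nat a * (t i / c)"
          using c0 unfolding cc[symmetric] by (simp add: field_simps)
        ultimately show ?thesis using Pair True by (simp add: h_def)
      next
        case False
        then have "{q \<in> verts ?H. {p, q} \<in> edges ?H} = {(i, 0)}"
          using i unfolding Pair by (auto simp: vH nb_C3_pendant)
        then show ?thesis using Pair False c0 by (simp add: h_def)
      qed
    qed
    then obtain f where "f \<in> eig (verts G)" "\<And>p. p \<in> verts ?H \<Longrightarrow> f (F p) = h p"
      using iso_eig[OF F adj, of h] unfolding c_def by blast
    then show ?thesis by (intro bexI[of _ f]) (auto simp: vH h_def)
  qed
  define t1 t2 :: "nat \<Rightarrow> complex" where "t1 = (\<lambda>i. if i = 0 then 1 else if i = 1 then - 1 else 0)"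
    and "t2 = (\<lambda>i. if i = 0 then 0 else if i = 1 then - 1 else 1)"
  have "t1 0 + t1 1 + t1 2 = 0" "t2 0 + t2 1 + t2 2 = 0" by (simp_all add: t1_def t2_def)
  from this[THEN ex] obtain f1 f2 where f: "f1 \<in> eig (verts G)" "f2 \<in> eig (verts G)"
    "f1 (F (0, 0)) = t1 0" "f2 (F (0, 0)) = t2 0" "f2 (F (1, 0)) = t2 1"
    by (metis less_3)
  have "2 \<le> mult (verts G)"
    by (rule mult_ge_2[OF finite_verts f(1) _ f(2), of "F (0, 0)" "F (1, 0)"])
      (simp_all only: f(3-5), simp_all add: t1_def t2_def)
  moreover have "imn (verts G) \<le> 1"
  proof (rule iso_imn_le_1[OF F adj])
    \<comment> \<open>Disjoint edges contain different triangle vertices, and these are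
      adjacent.\<close>
    have hub: "\<exists>i<3. (i, 0) \<in> e" if e: "e \<in> edges ?H" for e
    proof -
      consider "e = {(0, 0), (1, 0)}" | "e = {(1, 0), (2, 0)}" | "e = {(2, 0), (0, 0)}"
        | i j where "e = {(i, 0), (i, j)}" "i < 3"
        using e by (auto simp: C3_pendant_def edges_C3)
      then show ?thesis
      proof cases
        case 1
        then show ?thesis by (intro exI[of _ 0]) simp
      next
        case 2
        then show ?thesis by (intro exI[of _ 1]) simp
      next
        case 3
        then show ?thesis by (intro exI[of _ 0]) simp
      next
        case (4 i j)
        then show ?thesis by (intro exI[of _ i]) simp
      qed
    qed
    fix e f assume "e \<in> edges ?H" "f \<in> edges ?H" "e \<inter> f = {}"
    then obtain i k where ik: "i < 3" "(i, 0) \<in> e" "k < 3" "(k, 0) \<in> f" "i \<noteq> k"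
      using hub[of e] hub[of f] by blast
    then have "{(i, 0), (k, 0)} \<in> edges ?H" by (simp add: nb_C3_pendant)
    then show "\<exists>u\<in>e. \<exists>v\<in>f. {u, v} \<in> edges ?H" using ik by blast
  qed
  moreover have "cyc (verts G) \<le> 1"
  proof -
    let ?A = "(\<lambda>e. (\<lambda>i. (i, 0::nat)) ` e) ` edges (cycle_graph 3)"
    let ?B = "(\<lambda>(i, j). {(i, 0), (i, j)}) ` ({..<3::nat} \<times> {1..a})"
    have e: "edges ?H \<subseteq> ?A \<union> ?B"
    proof
      fix e assume "e \<in> edges ?H"
      then consider "e \<in> ?A" | i j where "e = {(i, 0), (i, j)}" "i < 3" "1 \<le> j" "j \<le> a"
        unfolding C3_pendant_def by auto
      then show "e \<in> ?A \<union> ?B"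
      proof cases
        case (2 i j)
        then have "e \<in> ?B" by (intro image_eqI[of _ _ "(i, j)"]) simp_all
        then show ?thesis by (rule UnI2)
      qed (rule UnI1)
    qed
    have A: "finite ?A" "card ?A \<le> 3"
      using card_image_le[of "{..<3::nat}" "\<lambda>i. {i, (i + 1) mod 3}"]
        card_image_le[of "edges (cycle_graph 3)" "\<lambda>e. (\<lambda>i. (i, 0::nat)) ` e"]
      by (simp_all add: cycle_graph_def)
    have B: "finite ?B" "card ?B \<le> 3 * a"
      using card_image_le[of "{..<3::nat} \<times> {1..a}" "\<lambda>(i, j). {(i, 0), (i, j)}"]
      by (simp_all add: card_cartesian_product)
    have "finite (?A \<union> ?B)" "card (?A \<union> ?B) \<le> 3 + 3 * a"
      using A B card_Un_le[of ?A ?B] by simp_all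
    then have "card (edges ?H) \<le> 3 + 3 * a" "finite (edges ?H)"
      using e card_mono[of "?A \<union> ?B" "edges ?H"] finite_subset[of "edges ?H"] by (blast intro: le_trans)+
    then show ?thesis using iso_cyc_le[OF F adj G(2)] by (simp add: vH card_cartesian_product)
  qed
  ultimately show ?thesis using sgraph_extremalI[OF G y] y by blast
qed

section \<open>Isomorphisms obtained from the core cycle\<close>

context extremal_set
begin

lemma nb_core_leaves: "nb S z = core S z \<union> leaves z"
  by (auto simp: leaves_def core_def)

text \<open>The five rotations of the cycle all satisfy \<open>pentagon_no_leaf\<close>, so no
  pendant vertex is left and the graph is the cycle itself.\<close>

lemma pentagon_iso:
  assumes S: "S = verts G" and conn: "reach S x = S" and x: "x \<in> S" "cyclic S x"
    and d: "distinct [x, p1, p2, p3, p4]"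
    and core: "core S x = {p1, p4}" "core S p1 = {x, p2}" "core S p2 = {p1, p3}"
      "core S p3 = {p2, p4}" "core S p4 = {x, p3}"
  shows "graph_iso G (cycle_graph 5)"
proof -
  have imn: "imn S \<le> 1" by (rule imn_le_1[OF conn x])
  have p: "p1 \<in> S" "cyclic S p1" "p2 \<in> S" "cyclic S p2" "p3 \<in> S" "cyclic S p3" "p4 \<in> S" "cyclic S p4"
    using core_in[of p1 x] core_in[of p4 x] core_in[of p2 p1] core_in[of p3 p4] core by auto
  have l0: "leaves x = {}" by (rule pentagon_no_leaf[OF imn x core(1) _ p(3,4), of p3]) (use core d in auto)
  have l1: "leaves p1 = {}"
    by (rule pentagon_no_leaf[OF imn p(1,2), of p2 x p4 p3]) (use core d p in auto)
  have l2: "leaves p2 = {}"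
    by (rule pentagon_no_leaf[OF imn p(3,4), of p3 p1 x p4]) (use core d p in auto)
  have l3: "leaves p3 = {}"
    by (rule pentagon_no_leaf[OF imn p(5,6), of p4 p2 p1 x]) (use core d p x in auto)
  have l4: "leaves p4 = {}"
    by (rule pentagon_no_leaf[OF imn p(7,8), of x p3 p2 p1]) (use core d p in auto)
  note leafless = l0 l1 l2 l3 l4
  have "S = {x, p1, p2, p3, p4} \<union> (\<Union>z\<in>{x, p1, p2, p3, p4}. leaves z)"
    by (rule closed_core[OF conn]) (use x p core in auto)
  also have "\<dots> = {x, p1, p2, p3, p4}" by (simp add: leafless)
  finally have V: "S = {x, p1, p2, p3, p4}" .
  have nb: "nb S x = {p1, p4}" "nb S p1 = {x, p2}" "nb S p2 = {p1, p3}" "nb S p3 = {p2, p4}" "nb S p4 = {x, p3}"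
    unfolding nb_core_leaves leafless core by simp_all
  have edge: "{u, v} \<in> edges G \<longleftrightarrow> v \<in> nb S u" for u v by (simp add: S nb_verts)
  define F where "F = (\<lambda>i::nat. if i = 0 then x else if i = 1 then p1 else if i = 2 then p2 else if i = 3 then p3 else p4)"
  have F: "F 0 = x" "F 1 = p1" "F 2 = p2" "F 3 = p3" "F 4 = p4" by (simp_all add: F_def)
  let ?H = "cycle_graph 5"
  have H: "verts ?H = {0, 1, 2, 3, 4}" by (auto simp: cycle_graph_def)
  have inj: "inj_on F (verts ?H)" unfolding H using d by (auto simp: inj_on_def F_def)
  moreover have "F ` verts ?H = verts G" unfolding H S[symmetric] V by (auto simp: F_def)
  ultimately have "bij_betw F (verts ?H) (verts G)" by (simp add: bij_betw_def)
  moreover have "{F i, F j} \<in> edges G \<longleftrightarrow> {i, j} \<in> edges ?H" if ij: "i \<in> verts ?H" "j \<in> verts ?H" for i j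
  proof -
    have "nb S (F i) = F ` {q \<in> verts ?H. {i, q} \<in> edges ?H}"
    proof -
      consider "i = 0" | "i = 1" | "i = 2" | "i = 3" | "i = 4" using ij(1) unfolding H by blast
      then show ?thesis
        by cases (simp_all only: nbs_C5 F nb image_insert image_empty, auto)
    qed
    then show ?thesis unfolding edge using inj_on_image_mem_iff[OF inj ij(2)] ij(2) by simp
  qed
  ultimately show ?thesis unfolding graph_iso_inverse by blast
qed

text \<open>By \<open>triangle_leaves\<close> all three leaf counts equal the same number
  \<open>lam * lam + lam\<close>; this common count is \<open>a\<close>, and numbering the leaves at
  each corner gives the isomorphism.\<close>

lemma triangle_iso:
  assumes S: "S = verts G" and conn: "reach S x = S" and x: "x \<in> S" "cyclic S x"
    and d: "distinct [x, y, z]"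
    and core: "core S x = {y, z}" "core S y = {x, z}" "core S z = {x, y}"
  shows "\<exists>a. graph_iso G (C3_pendant a)"
proof -
  have p: "y \<in> S" "cyclic S y" "z \<in> S" "cyclic S z" using core_in[of y x] core_in[of z x] core by auto
  define T where "T = (\<lambda>i::nat. if i = 0 then x else if i = 1 then y else z)"
  have T3: "T ` {..<3} = {x, y, z}" by (auto simp: T_def image_iff less_3)
  have T_inj: "T i = T k \<longleftrightarrow> i = k" if "i < 3" "k < 3" for i k
    using that d by (auto simp: T_def less_3)
  have TS: "T i \<in> S" "cyclic S (T i)" for i using x p by (auto simp: T_def)
  have T_core: "core S (T i) = T ` ({..<3} - {i})" if "i < 3" for i
  proof -
    have "{..<3} - {0} = {1, 2::nat}" "{..<3} - {1} = {0, 2::nat}" "{..<3} - {2} = {0, 1::nat}" by auto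
    then show ?thesis using that core unfolding less_3 by (elim disjE) (auto simp: T_def)
  qed
  have eq: "of_nat (card (leaves u)) = lam * lam + lam" if u: "u \<in> {x, y, z}" for u
  proof -
    consider "u = x" | "u = y" | "u = z" using u by blast
    then show ?thesis
    proof cases
      case 1
      then show ?thesis using triangle_leaves[OF p(1,2), of z x] core d by (auto simp: insert_commute)
    next
      case 2
      then show ?thesis using triangle_leaves[OF x, of z y] core d by (auto simp: insert_commute)
    next
      case 3
      then show ?thesis using triangle_leaves[OF x, of y z] core d by auto
    qed
  qed
  define a where "a = card (leaves x)"
  have "(of_nat (card (leaves (T i))) :: complex) = of_nat a" for i
    unfolding a_def using eq[of "T i"] eq[of x] by (simp add: T_def)
  then have a: "card (leaves (T i)) = a" for i by simp
  have finl: "finite (leaves u)" for u using fin by (simp add: leaves_def)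
  have "\<exists>L. bij_betw L {1..a} (leaves (T i))" for i
    using a[of i] finl by (intro finite_same_card_bij) simp_all
  then obtain L where L: "\<And>i. bij_betw (L i) {1..a} (leaves (T i))" by metis
  have L_in: "L i j \<in> leaves (T i)" if "1 \<le> j" "j \<le> a" for i j
    using L[of i] that by (auto simp: bij_betw_def)
  have L_leaf: "nb S (L i j) = {T i}" "\<not> cyclic S (L i j)" if "1 \<le> j" "j \<le> a" for i j
    using leaf_nb[OF TS L_in[OF that]] by auto
  have L_inj: "L i j = L k l \<longleftrightarrow> i = k \<and> j = l"
    if "i < 3" "1 \<le> j" "j \<le> a" "k < 3" "1 \<le> l" "l \<le> a" for i j k l
  proof
    assume e: "L i j = L k l"
    then have "T i = T k" using L_leaf(1)[of j i] L_leaf(1)[of l k] that by simp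
    then have "i = k" using T_inj that by simp
    moreover have "inj_on (L i) {1..a}" using L[of i] by (simp add: bij_betw_def)
    ultimately show "i = k \<and> j = l" using e that by (simp add: inj_on_eq_iff)
  qed simp
  have TL: "T i \<noteq> L k l" if "1 \<le> l" "l \<le> a" for i k l using TS(2)[of i] L_leaf(2)[OF that] by metis
  define F where "F = (\<lambda>(i, j). if j = 0 then T i else L i j)"
  have F: "F (i, j) = (if j = 0 then T i else L i j)" for i j by (simp add: F_def)
  let ?H = "C3_pendant a"
  have H: "verts ?H = {..<3} \<times> {..a}" by (simp add: C3_pendant_def)
  have edge: "{u, v} \<in> edges G \<longleftrightarrow> v \<in> nb S u" for u v by (simp add: S nb_verts)
  have "S = {x, y, z} \<union> (\<Union>u\<in>{x, y, z}. leaves u)"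
    by (rule closed_core[OF conn]) (use x p core in auto)
  then have V: "S \<subseteq> T ` {..<3} \<union> (\<Union>i<3. leaves (T i))"
    unfolding T3[symmetric] by (intro equalityD1) simp
  have "F ` verts ?H = S"
  proof
    have "L i j \<in> S" if "1 \<le> j" "j \<le> a" for i j using leaf_nb[OF TS L_in[OF that]] by blast
    then show "F ` verts ?H \<subseteq> S" using TS(1) by (auto simp: H F)
    show "S \<subseteq> F ` verts ?H"
    proof
      fix u assume "u \<in> S"
      then consider i where "i < 3" "u = T i" | i where "i < 3" "u \<in> leaves (T i)" using V by blast
      then show "u \<in> F ` verts ?H"
      proof cases
        case 1
        then show ?thesis by (intro image_eqI[of _ _ "(i, 0)"]) (auto simp: H F)
      next
        case 2
        then have "u \<in> L i ` {1..a}" using L[of i] by (simp add: bij_betw_def)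
        then obtain j where "1 \<le> j" "j \<le> a" "u = L i j" by auto
        then show ?thesis using 2 by (intro image_eqI[of _ _ "(i, j)"]) (auto simp: H F)
      qed
    qed
  qed
  moreover have "inj_on F (verts ?H)"
  proof (rule inj_onI)
    fix p q assume pq: "p \<in> verts ?H" "q \<in> verts ?H" "F p = F q"
    obtain i j k l where ij: "p = (i, j)" "q = (k, l)" by (cases p; cases q)
    show "p = q"
      using pq T_inj[of i k] L_inj[of i j k l] TL[of l i k] TL[of j k i]
      unfolding ij by (cases "j = 0"; cases "l = 0") (simp_all add: H F)
  qed
  ultimately have "bij_betw F (verts ?H) (verts G)" by (simp add: bij_betw_def S)
  moreover have "{F p, F q} \<in> edges G \<longleftrightarrow> {p, q} \<in> edges ?H" if pq: "p \<in> verts ?H" "q \<in> verts ?H" for p q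
  proof -
    obtain i j k l where ij: "p = (i, j)" "q = (k, l)" by (cases p; cases q)
    have b: "i < 3" "j \<le> a" "k < 3" "l \<le> a" using pq by (auto simp: ij H)
    have "F q \<in> nb S (F p) \<longleftrightarrow> j = 0 \<and> l = 0 \<and> i \<noteq> k \<or> i = k \<and> (j = 0 \<and> 1 \<le> l \<or> l = 0 \<and> 1 \<le> j)"
    proof (cases "j = 0")
      case j: True
      show ?thesis
      proof (cases "l = 0")
        case True
        have "T k \<in> T ` ({..<3} - {i}) \<longleftrightarrow> i \<noteq> k" using b T_inj by auto
        then show ?thesis using j True b TS(2)[of k] T_core[of i]
          by (simp add: ij F nb_cyclic)
      next
        case False
        then have l: "1 \<le> l" by simp
        have "L k l \<in> nb S (T i) \<longleftrightarrow> T i \<in> nb S (L k l)"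
          using nb_sym[of "L k l" S "T i"] nb_sym[of "T i" S "L k l"] TS(1)[of i]
            leaf_nb[OF TS L_in[OF l b(4)]] by blast
        also have "\<dots> \<longleftrightarrow> i = k" using L_leaf(1)[OF l b(4)] T_inj b by simp
        finally show ?thesis using j False by (simp add: ij F)
      qed
    next
      case False
      then have j: "1 \<le> j" by simp
      show ?thesis
        using L_leaf(1)[OF j b(2), of i] False T_inj[of k i] TL[of l i k] b
        by (cases "l = 0") (auto simp: ij F)
    qed
    then show ?thesis unfolding edge ij nb_C3_pendant using b by auto
  qed
  ultimately show ?thesis unfolding graph_iso_inverse by blast
qed

end

lemma extremal_classification:
  fixes G :: "'a ugraph" and y :: real
  assumes G: "simple_graph G" "connected_graph G" and y: "y \<noteq> 0" "eigenvalue (adj_matrix G) y"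
    and eq: "int (eigenvalue_mult G y) = int (induced_matching_number G) + cyclomatic_number G"
  shows "(\<exists>a. graph_iso G (C3_pendant a)) \<or> graph_iso G (cycle_graph 5) \<or>
    (is_tree G \<and> graph_diameter G \<in> {1, 2, 3})"
proof -
  interpret graph_ev G "complex_of_real y" by unfold_locales (use G y in simp_all)
  let ?V = "verts G"
  have ext: "extremal ?V" using eq
    by (simp add: extremal_def eigenvalue_mult_eq[OF y(1)] induced_matching_number_eq cyclomatic_number_eq)
  interpret extremal_set G "complex_of_real y" ?V
    by unfold_locales (fact finite_verts, fact ext)
  have conn: "reach ?V u = ?V" if "u \<in> ?V" for u using G(2) that by (simp add: connected_graph_iff)
  show ?thesis
  proof (cases "\<exists>x\<in>?V. cyclic ?V x")
    case True
    then obtain x where x: "x \<in> ?V" "cyclic ?V x" by blast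
    show ?thesis
    proof (cases rule: core_cycle[OF conn[OF x(1)] x])
      case (1 y z)
      then show ?thesis using triangle_iso[OF refl conn[OF x(1)] x] by blast
    next
      case (2 y1 z1 z2 y2)
      then have "graph_iso G (cycle_graph 5)"
        by (intro pentagon_iso[OF refl conn[OF x(1)] x, of y1 z1 z2 y2]) auto
      then show ?thesis by blast
    qed
  next
    case False
    \<comment> \<open>A nonzero multiplicity requires an edge, which excludes the single vertex and
      with it diameter 0.\<close>
    have "0 < mult ?V" using y by (simp add: eigenvalue_iff_mult eigenvalue_mult_eq)
    then obtain a b where ab: "a \<in> ?V" "b \<in> nb ?V a" using mult_edgeless[of ?V] by auto
    have tree: "is_tree G" using False G(2) by (simp add: is_tree_iff)
    have acyclic: "\<not> cyclic ?V x" if "x \<in> ?V" for x using False that by blast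
    obtain v w where "v \<in> ?V" "w \<in> ?V"
      and vw: "w \<in> nb ?V v \<or> w = v" "?V \<subseteq> {v, w} \<union> nb ?V v \<union> nb ?V w"
      by (rule acyclic_structure[OF acyclic ab conn])
    have "graph_diameter G \<le> 3" using ab vw by (intro diameter_le_3) auto
    moreover have "0 < graph_diameter G" using diameter_pos_iff[OF G(2)] ab by blast
    ultimately have "graph_diameter G \<in> {1, 2, 3}" by auto
    then show ?thesis using tree by blast
  qed
qed

text \<open>The bound is 1 here, since \<open>cyc\<close> is zero and \<open>imn\<close> is one, and
  any nonzero eigenvalue has multiplicity at least one.\<close>

lemma tree_diameter_le_3_extremal:
  fixes G :: "'a ugraph" and x :: real
  assumes G: "simple_graph G" and tree: "is_tree G" "graph_diameter G \<in> {1, 2, 3}"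
    and x: "x \<noteq> 0" "eigenvalue (adj_matrix G) x"
  shows "int (eigenvalue_mult G x) = int (induced_matching_number G) + cyclomatic_number G"
proof -
  interpret graph_ev G "complex_of_real x" by unfold_locales (use G x in simp_all)
  let ?V = "verts G"
  have conn: "connected_graph G" using tree by (simp add: is_tree_def)
  have cyc: "cyc ?V = 0" using tree(1) by (intro cyc_acyclic[OF finite_verts]) (simp add: is_tree_iff)
  obtain a b where ab: "a \<in> ?V" "b \<in> nb ?V a" using diameter_pos_iff[OF conn] tree(2) by auto
  have "imn ?V \<le> 1" using tree by (intro tree_imn_le_1[OF _ _ ab]) auto
  moreover have "1 \<le> imn ?V" using ab by (intro imn_pos[of a b]) (auto simp: nb_def)
  moreover have "0 < mult ?V" using x by (simp add: eigenvalue_iff_mult eigenvalue_mult_eq)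
  moreover have "int (mult ?V) \<le> int (imn ?V) + cyc ?V" by (rule mult_le[OF finite_verts])
  ultimately show ?thesis using cyc
    by (simp add: eigenvalue_mult_eq[OF x(1)] induced_matching_number_eq cyclomatic_number_eq)
qed

text \<open>Equality is stated for some nonzero eigenvalue \<open>y\<close> because the cyclic
  families do not attain it at every one: the eigenvalue 2 of the pentagon is simple while the bound
  is 2. Trees of diameter 1 to 3 attain it at each nonzero eigenvalue, which the last conjunct
  records.\<close>

theorem theorem3p1:
  fixes G :: "'a ugraph" and x :: real
  assumes "simple_graph G" and "connected_graph G"
    and "x \<noteq> 0" and "eigenvalue (adj_matrix G) x"
  shows "int (eigenvalue_mult G x) \<le> int (induced_matching_number G) + cyclomatic_number G
    \<and> ((\<exists>y. y \<noteq> 0 \<and> eigenvalue (adj_matrix G) y \<and>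
            int (eigenvalue_mult G y) = int (induced_matching_number G) + cyclomatic_number G)
        \<longleftrightarrow> (\<exists>a. graph_iso G (C3_pendant a)) \<or> graph_iso G (cycle_graph 5) \<or>
            (is_tree G \<and> graph_diameter G \<in> {1, 2, 3}))
    \<and> (is_tree G \<and> graph_diameter G \<in> {1, 2, 3} \<longrightarrow>
         int (eigenvalue_mult G x) = int (induced_matching_number G) + cyclomatic_number G)"
proof (intro conjI iffI impI)
  interpret graph_ev G "complex_of_real x" by unfold_locales (use assms in simp_all)
  show "int (eigenvalue_mult G x) \<le> int (induced_matching_number G) + cyclomatic_number G"
    using mult_le[OF finite_verts]
    by (simp add: eigenvalue_mult_eq[OF assms(3)] induced_matching_number_eq cyclomatic_number_eq)
next
  assume "\<exists>y. y \<noteq> 0 \<and> eigenvalue (adj_matrix G) y \<and>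
    int (eigenvalue_mult G y) = int (induced_matching_number G) + cyclomatic_number G"
  then show "(\<exists>a. graph_iso G (C3_pendant a)) \<or> graph_iso G (cycle_graph 5) \<or>
    (is_tree G \<and> graph_diameter G \<in> {1, 2, 3})"
    using extremal_classification[OF assms(1,2)] by blast
next
  assume "(\<exists>a. graph_iso G (C3_pendant a)) \<or> graph_iso G (cycle_graph 5) \<or>
    (is_tree G \<and> graph_diameter G \<in> {1, 2, 3})"
  then show "\<exists>y. y \<noteq> 0 \<and> eigenvalue (adj_matrix G) y \<and>
    int (eigenvalue_mult G y) = int (induced_matching_number G) + cyclomatic_number G"
    using iso_C3_pendant_extremal[OF assms(1,2)] iso_C5_extremal[OF assms(1,2)]
      tree_diameter_le_3_extremal[OF assms(1) _ _ assms(3,4)] assms(3,4) by blast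
next
  assume "is_tree G \<and> graph_diameter G \<in> {1, 2, 3}"
  then show "int (eigenvalue_mult G x) = int (induced_matching_number G) + cyclomatic_number G"
    using tree_diameter_le_3_extremal[OF assms(1) _ _ assms(3,4)] by blast
qed

end
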